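(* Let $H_1,H_2$ be Sidorenko graphs and let $e_1\in E(H_1)$, $e_2\in E(H_2)$ be arbitrary edges. Then the graph $H$ obtained from the disjoint union of $H_1$ and $H_2$ by identifying the edge $e_1$ with the edge $e_2$ (in either of the two possible ways of matching their endpoints) is also a Sidorenko graph.
   Context: A graphon is a symmetric measurable function $W:[0,1]^2\to[0,1]$. For a finite graph $H$ with vertices $x_1,\dots,x_m$, $t(H,W)=\int_{[0,1]^m}\prod_{(x_i,x_j)\in E(H)}W(x_i,x_j)\,dx_1\cdots dx_m$. A bipartite graph $H$ with $e$ edges is a Sidorenko graph if $t(H,W)\geq \bigl(\int_{[0,1]^2}W\bigr)^e$ for every graphon $W$. *)

theory Defs
  imports "HOL-Analysis.Analysis"
begin

record 'a graph =
  verts :: "'a set"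
  edges :: "'a set set"

definition finite_simple_graph :: "'a graph \<Rightarrow> bool" where
  "finite_simple_graph H \<longleftrightarrow> finite (verts H) \<and>
     (\<forall>e\<in>edges H. \<exists>u\<in>verts H. \<exists>v\<in>verts H. u \<noteq> v \<and> e = {u, v})"

definition bipartite :: "'a graph \<Rightarrow> bool" where
  "bipartite H \<longleftrightarrow> (\<exists>A B. A \<union> B = verts H \<and> A \<inter> B = {} \<and>
     (\<forall>e\<in>edges H. \<exists>u\<in>A. \<exists>v\<in>B. e = {u, v}))"

definition unit_measure :: "real measure" where
  "unit_measure = restrict_space lborel {0..1}"

text \<open>Only the values on the unit square matter. Measurability is Borel measurability, so that
  the integrand of the homomorphism density below is measurable for the product sigma-algebra.\<close>

definition graphon :: "(real \<Rightarrow> real \<Rightarrow> real) \<Rightarrow> bool" where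
  "graphon W \<longleftrightarrow>
     case_prod W \<in> borel_measurable (unit_measure \<Otimes>\<^sub>M unit_measure) \<and>
     (\<forall>x\<in>{0..1}. \<forall>y\<in>{0..1}. W x y = W y x \<and> W x y \<in> {0..1})"

text \<open>Edges are unordered pairs; for \<open>e = {u, v}\<close> the factor contributed by \<open>e\<close> is
  \<open>W (x u) (x v)\<close>, which is well defined because graphons are symmetric.\<close>

definition edge_weight :: "(real \<Rightarrow> real \<Rightarrow> real) \<Rightarrow> ('a \<Rightarrow> real) \<Rightarrow> 'a set \<Rightarrow> real" where
  "edge_weight W x e = (THE r. \<exists>u v. e = {u, v} \<and> r = W (x u) (x v))"

lemma edge_weight_eq:
  assumes "W (x u) (x v) = W (x v) (x u)"
  shows "edge_weight W x {u, v} = W (x u) (x v)"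
  unfolding edge_weight_def
  by (rule the_equality) (use assms in \<open>auto simp: doubleton_eq_iff\<close>)

definition hom_density :: "'a graph \<Rightarrow> (real \<Rightarrow> real \<Rightarrow> real) \<Rightarrow> real" where
  "hom_density H W =
     (LINT x | PiM (verts H) (\<lambda>_. unit_measure). (\<Prod>e\<in>edges H. edge_weight W x e))"

definition sidorenko :: "'a graph \<Rightarrow> bool" where
  "sidorenko H \<longleftrightarrow> finite_simple_graph H \<and> bipartite H \<and>
     (\<forall>W. graphon W \<longrightarrow>
        hom_density H W \<ge>
          (LINT p | (unit_measure \<Otimes>\<^sub>M unit_measure). case_prod W p) ^ card (edges H))"

definition disjoint_union :: "'a graph \<Rightarrow> 'b graph \<Rightarrow> ('a + 'b) graph" where
  "disjoint_union H1 H2 =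
     \<lparr>verts = verts H1 <+> verts H2,
      edges = (`) Inl ` edges H1 \<union> (`) Inr ` edges H2\<rparr>"

definition map_graph :: "('a \<Rightarrow> 'b) \<Rightarrow> 'a graph \<Rightarrow> 'b graph" where
  "map_graph f H = \<lparr>verts = f ` verts H, edges = (`) f ` edges H\<rparr>"

text \<open>Identify the edge \<open>{u1, v1}\<close> of \<open>H1\<close> with the edge \<open>{u2, v2}\<close> of \<open>H2\<close>, matching \<open>u1\<close>
  with \<open>u2\<close> and \<open>v1\<close> with \<open>v2\<close>: the image of the disjoint union under the map that sends each
  vertex to the chosen representative of its class. The two edges become one single edge.
  The other matching of the endpoints is obtained by exchanging \<open>u2\<close> and \<open>v2\<close>.\<close>

definition glue_edges ::
  "'a graph \<Rightarrow> 'a \<Rightarrow> 'a \<Rightarrow> 'b graph \<Rightarrow> 'b \<Rightarrow> 'b \<Rightarrow> ('a + 'b) graph" where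
  "glue_edges H1 u1 v1 H2 u2 v2 =
     map_graph (id(Inr u2 := Inl u1, Inr v2 := Inl v1)) (disjoint_union H1 H2)"

end

theory Submission
  imports Defs "HOL-Probability.Probability"
begin

text \<open>
  Write \<open>f\<^sub>i s t\<close> for the density of \<open>H\<^sub>i\<close> without the edge \<open>{u\<^sub>i, v\<^sub>i}\<close>, conditioned on
  \<open>u\<^sub>i \<mapsto> s\<close> and \<open>v\<^sub>i \<mapsto> t\<close>, and let \<open>p = \<integral>W\<close>. Then \<open>t(H, W) = \<integral>W f\<^sub>1 f\<^sub>2\<close>, and by Jensen's
  inequality for the logarithm under the probability density \<open>W / p\<close> it suffices to show
  \<open>\<integral>W ln f\<^sub>i \<ge> p (e(H\<^sub>i) - 1) ln p\<close> (with \<open>f\<^sub>i + \<delta>\<close> in place of \<open>f\<^sub>i\<close> to keep the logarithm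
  bounded, and \<open>\<delta> \<rightarrow> 0\<close> at the end).

  This is the tensor power trick. Let \<open>K\<close> be the mean of \<open>ln f\<^sub>i\<close>. In the \<open>n\<close>-th tensor power of
  \<open>W\<close>, by the weak law of large numbers, at least half of the mass lies on the set where the tensor power
  of \<open>f\<^sub>i\<close> is at most \<open>exp (n (K + \<epsilon>))\<close> in both orientations. Restricting the tensor power to this
  symmetric set, Sidorenko's inequality gives \<open>(p\<^sup>n / 2)\<^bsup>e(H\<^sub>i)\<^esup> \<le> exp (n (K + \<epsilon>)) p\<^sup>n\<close>, and the claim follows
  with \<open>n \<rightarrow> \<infinity>\<close>. Tensor squares are realised on \<open>[0, 1]\<close> by a measure preserving map from the unit
  interval to the unit square, so \<open>n\<close> runs through the powers of two.
\<close>

section \<open>The unit interval as a probability space\<close>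

lemma space_unit_measure [simp]: "space unit_measure = {0..1}"
  by (simp add: unit_measure_def space_restrict_space)

interpretation unit_measure: prob_space unit_measure
  by (rule prob_spaceI) (simp add: unit_measure_def space_restrict_space emeasure_restrict_space)

lemma sets_unit_measure: "sets unit_measure = sets (restrict_space borel {0..1})"
  unfolding unit_measure_def by (rule sets_restrict_space_cong) simp

lemma measurable_unit_measure_iff:
  "f \<in> measurable M unit_measure \<longleftrightarrow> f \<in> borel_measurable M \<and> f \<in> space M \<rightarrow> {0..1}"
  by (subst measurable_cong_sets[OF refl sets_unit_measure])
     (auto simp: measurable_restrict_space2_iff)

lemma measurable_unit_measure_borel [measurable]: "(\<lambda>x. x) \<in> borel_measurable unit_measure"
  using measurable_unit_measure_iff[of "\<lambda>x. x" unit_measure] by simp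

section \<open>A measure preserving map from the unit interval to the unit square\<close>

text \<open>After scaling by \<open>4 ^ k\<close>, the digits before position \<open>k\<close>
  contribute multiples of 4 and the tail contributes at most 1/3, so the floor ends in digit
  \<open>k\<close> and its parity is that digit. Using only the digits 0 and 1 in base 4 avoids the
  ambiguity of binary expansions ending in repeated ones.\<close>

lemma odd_floor_base4_series:
  fixes b :: "nat \<Rightarrow> bool"
  shows "odd \<lfloor>4 ^ k * (\<Sum>j. of_bool (b j) * (1/4) ^ j :: real)\<rfloor> \<longleftrightarrow> b k"
proof -
  define d :: "nat \<Rightarrow> real" where "d j = of_bool (b j) * (1/4) ^ j" for j
  have geo: "summable (\<lambda>j. (1/4::real) ^ j)"
    by (simp add: summable_geometric)
  have d01: "0 \<le> d j" "d j \<le> (1/4) ^ j" for j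
    by (auto simp: d_def)
  have sd: "summable d"
    by (rule summable_comparison_test[OF _ geo]) (use d01 in auto)
  define t where "t = (\<Sum>j. d (j + Suc k))"
  have st: "summable (\<lambda>j. d (j + Suc k))"
    using sd by (subst summable_iff_shift)
  have t0: "0 \<le> t"
    unfolding t_def using st d01 by (intro suminf_nonneg) auto
  have "t \<le> (\<Sum>j. (1/4) ^ Suc k * (1/4) ^ j)"
    unfolding t_def using d01 geo
    by (intro suminf_le st summable_mult) (simp_all add: power_add[symmetric] add.commute del: power_Suc)
  also have "\<dots> = (1/4) ^ Suc k * (4/3)"
    by (subst suminf_mult[OF geo]) (simp add: suminf_geometric)
  finally have t1: "4 ^ k * t \<le> 1/3"
    by (simp add: field_simps power_one_over)
  have "(\<Sum>j. d j) = t + (\<Sum>j<Suc k. d j)"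
    unfolding t_def by (rule suminf_split_initial_segment[OF sd])
  hence "4 ^ k * (\<Sum>j. d j) = 4 ^ k * t + (\<Sum>j<k. 4 ^ k * d j) + 4 ^ k * d k"
    by (simp add: algebra_simps sum_distrib_right)
  also have "4 ^ k * d k = of_int (of_bool (b k))"
    by (simp add: d_def power_one_over)
  also have "(\<Sum>j<k. 4 ^ k * d j) = of_int (\<Sum>j<k. of_bool (b j) * 4 ^ (k - j))"
    unfolding of_int_sum
  proof (rule sum.cong)
    fix j assume "j \<in> {..<k}"
    hence "4 ^ k * (1/4) ^ j = (4::real) ^ (k - j)"
      by (simp add: power_diff power_one_over)
    thus "4 ^ k * d j = of_int (of_bool (b j) * 4 ^ (k - j))"
      by (simp add: d_def)
  qed simp
  finally have "\<lfloor>4 ^ k * (\<Sum>j. d j)\<rfloor> = (\<Sum>j<k. of_bool (b j) * 4 ^ (k - j)) + of_bool (b k)"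
    using t0 t1 by (intro floor_unique) (auto simp del: of_int_sum)
  moreover have "even (\<Sum>j<k. of_bool (b j) * 4 ^ (k - j) :: int)"
    by (intro dvd_sum) auto
  ultimately show ?thesis
    by (simp add: d_def)
qed

text \<open>This is the decoding formula: the rationals below \<open>x\<close> determine
  \<open>x\<close>. Replacing them by their clamped values and adding the default 0 does not change
  the supremum, because \<open>x\<close> lies in the unit interval.\<close>

lemma SUP_rat_below:
  fixes x :: real
  assumes "x \<in> {0..1}"
  shows "(SUP q. if of_rat q < x then max 0 (min 1 (of_rat q)) else 0) = x"
proof (rule cSup_eq_non_empty)
  show "range (\<lambda>q. if of_rat q < x then max 0 (min 1 (of_rat q)) else 0) \<noteq> {}"
    by blast
  fix y :: real assume "y \<in> range (\<lambda>q. if of_rat q < x then max 0 (min 1 (of_rat q)) else 0)"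
  thus "y \<le> x" using assms by (auto split: if_splits)
next
  fix y :: real assume *: "\<And>z. z \<in> range (\<lambda>q. if of_rat q < x then max 0 (min 1 (of_rat q)) else 0) \<Longrightarrow> z \<le> y"
  \<comment> \<open>The rational 2 is not below \<open>x\<close>, so it contributes the default
    value 0 to the range.\<close>
  have y0: "0 \<le> y"
    using *[OF rangeI, of 2] assms by simp
  show "x \<le> y"
  proof (rule ccontr)
    assume "\<not> x \<le> y"
    then obtain q where q: "y < of_rat q" "of_rat q < x"
      using of_rat_dense[of y x] by auto
    with *[of "of_rat q"] y0 assms show False
      by (force simp: image_iff)
  qed
qed

text \<open>A point is encoded by the bits \<open>q < x\<close> and \<open>q < y\<close> for rational \<open>q\<close>, written as base 4 digits.\<close>

lemma unit_square_encoding: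
  obtains enc :: "real \<times> real \<Rightarrow> real" and \<alpha> \<beta> :: "real \<Rightarrow> real"
  where "enc \<in> borel_measurable borel"
    and "\<alpha> \<in> measurable borel unit_measure" and "\<beta> \<in> measurable borel unit_measure"
    and "\<And>x y. x \<in> {0..1} \<Longrightarrow> y \<in> {0..1} \<Longrightarrow> \<alpha> (enc (x, y)) = x"
    and "\<And>x y. x \<in> {0..1} \<Longrightarrow> y \<in> {0..1} \<Longrightarrow> \<beta> (enc (x, y)) = y"
proof
  define b :: "real \<times> real \<Rightarrow> nat \<Rightarrow> bool" where
    "b z k = (case from_nat k of (s, q) \<Rightarrow> if s then of_rat q < fst z else of_rat q < snd z)" for z k
  define enc :: "real \<times> real \<Rightarrow> real" where
    "enc z = (\<Sum>k. of_bool (b z k) * (1/4) ^ k)" for z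
  \<comment> \<open>The supremum ranges over countably many \<open>q\<close>, which makes
    \<open>dec s\<close> Borel. The clamp keeps its values in the unit interval even at an
    \<open>r\<close> that encodes no point.\<close>
  define dec :: "bool \<Rightarrow> real \<Rightarrow> real" where
    "dec s r = (SUP q. if odd \<lfloor>4 ^ to_nat (s, q) * r\<rfloor> then max 0 (min 1 (of_rat q)) else 0)" for s r
  have b_meas [measurable]: "Measurable.pred borel (\<lambda>z. b z k)" for k
    unfolding b_def by (cases "from_nat k :: bool \<times> rat") (simp add: borel_prod[symmetric])
  show "enc \<in> borel_measurable borel"
    unfolding enc_def by measurable
  have odd: "odd \<lfloor>4 ^ k * enc z\<rfloor> \<longleftrightarrow> b z k" for k z
    unfolding enc_def by (rule odd_floor_base4_series)
  show "dec True (enc (x, y)) = x" if "x \<in> {0..1}" "y \<in> {0..1}" for x y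
    using SUP_rat_below[OF that(1)] by (simp add: dec_def odd b_def)
  show "dec False (enc (x, y)) = y" if "x \<in> {0..1}" "y \<in> {0..1}" for x y
    using SUP_rat_below[OF that(2)] by (simp add: dec_def odd b_def)
  have bdd: "bdd_above (range (\<lambda>q. if odd \<lfloor>4 ^ to_nat (s, q) * r\<rfloor>
      then max 0 (min 1 (of_rat q)) else (0::real)))" for s and r :: real
    by (rule bdd_aboveI[of _ 1]) auto
  have "dec s \<in> borel_measurable borel" for s
    unfolding dec_def by (intro borel_measurable_cSUP bdd) auto
  moreover have "dec s r \<in> {0..1}" for s r
  proof -
    have "dec s r \<le> 1"
      unfolding dec_def by (rule cSUP_least) auto
    moreover have "0 \<le> dec s r"
      unfolding dec_def by (rule cSUP_upper2[OF bdd, of 0]) auto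
    ultimately show ?thesis by simp
  qed
  ultimately show "dec True \<in> measurable borel unit_measure" "dec False \<in> measurable borel unit_measure"
    by (auto simp: measurable_unit_measure_iff)
qed

text \<open>The law of the encoded uniform point is a distribution on the real line, hence the image of the
  uniform distribution under its quantile function; decoding afterwards gives the map.\<close>

lemma unit_square_parametrization:
  obtains \<phi> \<psi> where "\<phi> \<in> measurable unit_measure unit_measure"
    and "\<psi> \<in> measurable unit_measure unit_measure"
    and "distr unit_measure (unit_measure \<Otimes>\<^sub>M unit_measure) (\<lambda>x. (\<phi> x, \<psi> x)) =
      unit_measure \<Otimes>\<^sub>M unit_measure"
proof -
  let ?U2 = "unit_measure \<Otimes>\<^sub>M unit_measure"
  obtain enc :: "real \<times> real \<Rightarrow> real" and \<alpha> \<beta> where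
    enc: "enc \<in> borel_measurable borel" and
    [measurable]: "\<alpha> \<in> measurable borel unit_measure" "\<beta> \<in> measurable borel unit_measure" and
    dec: "\<And>x y. x \<in> {0..1} \<Longrightarrow> y \<in> {0..1} \<Longrightarrow> \<alpha> (enc (x, y)) = x"
      "\<And>x y. x \<in> {0..1} \<Longrightarrow> y \<in> {0..1} \<Longrightarrow> \<beta> (enc (x, y)) = y"
    using unit_square_encoding by metis
  have "(\<lambda>z. (fst z, snd z)) \<in> measurable ?U2 (borel \<Otimes>\<^sub>M borel)"
    by measurable
  with enc have enc' [measurable]: "enc \<in> borel_measurable ?U2"
    by (simp add: borel_prod measurable_compose)
  define M where "M = distr ?U2 borel enc"
  interpret U2: pair_prob_space unit_measure unit_measure ..
  interpret M: cdf_distribution M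
    unfolding M_def cdf_distribution_def by (rule U2.real_distribution_distr) simp
  \<comment> \<open>\<open>M.I\<close> is the quantile function of \<open>M\<close> and is used on
    the open interval. The value 0 at the endpoints affects only a null set.\<close>
  define Q where "Q x = (if x \<in> {0<..<1} then M.I x else 0)" for x
  let ?O = "restrict_space lborel {0<..<1::real}"
  have Q_borel: "Q \<in> borel_measurable borel"
  proof -
    have "M.I \<in> borel_measurable (restrict_space borel {0<..<1})"
      by measurable
    thus ?thesis
      unfolding Q_def by (subst (asm) borel_measurable_restrict_space_iff)
        (auto simp: indicator_def of_bool_def if_distrib if_distribR cong: if_cong)
  qed
  hence [measurable]: "Q \<in> borel_measurable unit_measure"
    by (rule measurable_compose[OF measurable_unit_measure_borel])
  have "distr unit_measure borel Q = M"
  proof -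
    have "distr unit_measure borel Q = distr ?O borel M.I"
    proof (rule measure_eqI)
      fix A assume "A \<in> sets (distr unit_measure borel Q)"
      hence A [measurable]: "A \<in> sets borel" by simp
      have "emeasure (distr unit_measure borel Q) A = emeasure lborel (Q -` A \<inter> {0..1})"
        by (subst emeasure_distr, simp_all) (simp add: unit_measure_def emeasure_restrict_space)
      also have "\<dots> = emeasure lborel (Q -` A \<inter> {0<..<1})"
      proof (rule emeasure_eq_AE)
        show "AE x in lborel. x \<in> Q -` A \<inter> {0..1} \<longleftrightarrow> x \<in> Q -` A \<inter> {0<..<1}"
          using AE_lborel_singleton[of 0] AE_lborel_singleton[of 1] by eventually_elim auto
      qed (use measurable_sets[OF Q_borel A] in auto)
      also have "Q -` A \<inter> {0<..<1} = M.I -` A \<inter> {0<..<1}"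
        by (auto simp: Q_def)
      also have "emeasure lborel \<dots> = emeasure (distr ?O borel M.I) A"
        by (subst emeasure_distr) (auto simp: emeasure_restrict_space space_restrict_space)
      finally show "emeasure (distr unit_measure borel Q) A = emeasure (distr ?O borel M.I) A" .
    qed simp
    thus ?thesis by (simp add: M.distr_I_eq_M)
  qed
  hence "distr unit_measure ?U2 (\<lambda>x. (\<alpha> (Q x), \<beta> (Q x))) = distr M ?U2 (\<lambda>r. (\<alpha> r, \<beta> r))"
    by (subst distr_distr[symmetric, unfolded comp_def, where f = Q and N = borel]) simp_all
  also have "\<dots> = distr ?U2 ?U2 (\<lambda>z. (\<alpha> (enc z), \<beta> (enc z)))"
    unfolding M_def by (subst distr_distr) (simp_all add: comp_def)
  also have "\<dots> = distr ?U2 ?U2 (\<lambda>z. z)"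
    by (rule distr_cong) (auto simp: space_pair_measure dec)
  finally show ?thesis
    by (intro that[of "\<lambda>x. \<alpha> (Q x)" "\<lambda>x. \<beta> (Q x)"]) simp_all
qed

section \<open>Independent copies\<close>

text \<open>For a probability measure this says that \<open>S\<close> and \<open>T\<close> are
  independent random variables, each with law \<open>M\<close>. It is used for the unit interval,
  the unit square and the cubes of vertex positions.\<close>

definition indep_copies :: "'a measure \<Rightarrow> ('a \<Rightarrow> 'a) \<Rightarrow> ('a \<Rightarrow> 'a) \<Rightarrow> bool" where
  "indep_copies M S T \<longleftrightarrow> S \<in> measurable M M \<and> T \<in> measurable M M \<and>
     distr M (M \<Otimes>\<^sub>M M) (\<lambda>x. (S x, T x)) = M \<Otimes>\<^sub>M M"

lemma indep_copies_nn_integral: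
  assumes "indep_copies M S T" "sigma_finite_measure M"
    and [measurable]: "F \<in> borel_measurable M" "G \<in> borel_measurable M"
  shows "(\<integral>\<^sup>+x. F (S x) * G (T x) \<partial>M) = (\<integral>\<^sup>+x. F x \<partial>M) * (\<integral>\<^sup>+x. G x \<partial>M)"
proof -
  interpret sigma_finite_measure M by fact
  have [measurable]: "S \<in> measurable M M" "T \<in> measurable M M"
    and D: "distr M (M \<Otimes>\<^sub>M M) (\<lambda>x. (S x, T x)) = M \<Otimes>\<^sub>M M"
    using assms by (auto simp: indep_copies_def)
  have "(\<integral>\<^sup>+x. F (S x) * G (T x) \<partial>M) =
      (\<integral>\<^sup>+z. F (fst z) * G (snd z) \<partial>distr M (M \<Otimes>\<^sub>M M) (\<lambda>x. (S x, T x)))"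
    by (subst nn_integral_distr) auto
  also have "\<dots> = (\<integral>\<^sup>+x. \<integral>\<^sup>+y. F x * G y \<partial>M \<partial>M)"
    unfolding D by (subst nn_integral_fst[symmetric]) auto
  also have "\<dots> = (\<integral>\<^sup>+x. F x \<partial>M) * (\<integral>\<^sup>+x. G x \<partial>M)"
    by (simp add: nn_integral_cmult nn_integral_multc)
  finally show ?thesis .
qed

text \<open>Indicators of rectangles are products of test functions, and rectangles determine a
  product measure. Nonnegative test functions allow Tonelli's theorem in the constructions below
  without integrability conditions.\<close>

lemma indep_copiesI:
  assumes "sigma_finite_measure M"
    and [measurable]: "S \<in> measurable M M" "T \<in> measurable M M"
    and F: "\<And>F G :: 'a \<Rightarrow> ennreal. F \<in> borel_measurable M \<Longrightarrow> G \<in> borel_measurable M \<Longrightarrow>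
      (\<integral>\<^sup>+x. F (S x) * G (T x) \<partial>M) = (\<integral>\<^sup>+x. F x \<partial>M) * (\<integral>\<^sup>+x. G x \<partial>M)"
  shows "indep_copies M S T"
proof -
  have "M \<Otimes>\<^sub>M M = distr M (M \<Otimes>\<^sub>M M) (\<lambda>x. (S x, T x))"
  proof (rule pair_measure_eqI)
    fix A B assume AB [measurable]: "A \<in> sets M" "B \<in> sets M"
    have "emeasure (distr M (M \<Otimes>\<^sub>M M) (\<lambda>x. (S x, T x))) (A \<times> B) =
        (\<integral>\<^sup>+z. indicator (A \<times> B) z \<partial>distr M (M \<Otimes>\<^sub>M M) (\<lambda>x. (S x, T x)))"
      by (simp add: nn_integral_indicator)
    also have "\<dots> = (\<integral>\<^sup>+x. indicator A (S x) * indicator B (T x) \<partial>M)"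
      by (subst nn_integral_distr) (auto simp: indicator_times)
    also have "\<dots> = emeasure M A * emeasure M B"
      by (subst F) auto
    finally show "emeasure M A * emeasure M B =
      emeasure (distr M (M \<Otimes>\<^sub>M M) (\<lambda>x. (S x, T x))) (A \<times> B)" ..
  qed (use assms in simp_all)
  thus ?thesis
    using assms by (simp add: indep_copies_def)
qed

text \<open>The version for functions that change sign, such as centred logarithms.\<close>

lemma indep_copies_integral:
  fixes F G :: "'a \<Rightarrow> real"
  assumes "indep_copies M S T" "sigma_finite_measure M"
    and F: "integrable M F" and G: "integrable M G"
  shows "integrable M (\<lambda>x. F (S x) * G (T x))"
    and "(LINT x|M. F (S x) * G (T x)) = (LINT x|M. F x) * (LINT x|M. G x)"
proof -
  interpret pair_sigma_finite M M
    using assms by (simp add: pair_sigma_finite_def)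
  have [measurable]: "S \<in> measurable M M" "T \<in> measurable M M"
    and D: "distr M (M \<Otimes>\<^sub>M M) (\<lambda>x. (S x, T x)) = M \<Otimes>\<^sub>M M"
    using assms by (auto simp: indep_copies_def)
  have [measurable]: "F \<in> borel_measurable M" "G \<in> borel_measurable M"
    using F G by auto
  have int: "integrable (M \<Otimes>\<^sub>M M) (\<lambda>z. F (fst z) * G (snd z))"
  proof (rule Fubini_integrable)
    show "integrable M (\<lambda>x. LINT y|M. norm (F (fst (x, y)) * G (snd (x, y))))"
      using F by (simp add: abs_mult)
  qed (use G in auto)
  have "integrable (distr M (M \<Otimes>\<^sub>M M) (\<lambda>x. (S x, T x))) (\<lambda>z. F (fst z) * G (snd z))"
    unfolding D by (rule int)
  thus "integrable M (\<lambda>x. F (S x) * G (T x))"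
    by (subst (asm) integrable_distr_eq) auto
  have "(LINT x|M. F (S x) * G (T x)) =
      (LINT z|distr M (M \<Otimes>\<^sub>M M) (\<lambda>x. (S x, T x)). F (fst z) * G (snd z))"
    by (subst integral_distr) auto
  also have "\<dots> = (LINT x|M. LINT y|M. F x * G y)"
    unfolding D by (subst integral_fst'[OF int, symmetric]) simp
  finally show "(LINT x|M. F (S x) * G (T x)) = (LINT x|M. F x) * (LINT x|M. G x)"
    by simp
qed

text \<open>By Tonelli, the second coordinate is split for fixed first coordinate, and then the
  first coordinate is split.\<close>

lemma indep_copies_pair:
  assumes "indep_copies M S T" "sigma_finite_measure M"
    and "indep_copies N S' T'" "sigma_finite_measure N"
  shows "indep_copies (M \<Otimes>\<^sub>M N) (map_prod S S') (map_prod T T')"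
proof (rule indep_copiesI)
  interpret N: sigma_finite_measure N by fact
  interpret pair_sigma_finite M N
    using assms by (simp add: pair_sigma_finite_def)
  have [measurable]: "S \<in> measurable M M" "T \<in> measurable M M"
    "S' \<in> measurable N N" "T' \<in> measurable N N"
    using assms by (auto simp: indep_copies_def)
  show "sigma_finite_measure (M \<Otimes>\<^sub>M N)" ..
  show [measurable]: "map_prod S S' \<in> measurable (M \<Otimes>\<^sub>M N) (M \<Otimes>\<^sub>M N)"
    "map_prod T T' \<in> measurable (M \<Otimes>\<^sub>M N) (M \<Otimes>\<^sub>M N)"
    unfolding map_prod_def by measurable
  fix F G :: "'a \<times> 'b \<Rightarrow> ennreal"
  assume [measurable]: "F \<in> borel_measurable (M \<Otimes>\<^sub>M N)" "G \<in> borel_measurable (M \<Otimes>\<^sub>M N)"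
  have "(\<integral>\<^sup>+z. F (map_prod S S' z) * G (map_prod T T' z) \<partial>(M \<Otimes>\<^sub>M N)) =
      (\<integral>\<^sup>+x. \<integral>\<^sup>+y. F (S x, S' y) * G (T x, T' y) \<partial>N \<partial>M)"
    by (subst N.nn_integral_fst[symmetric]) (auto simp: map_prod_def)
  also have "\<dots> = (\<integral>\<^sup>+x. (\<integral>\<^sup>+y. F (S x, y) \<partial>N) * (\<integral>\<^sup>+y. G (T x, y) \<partial>N) \<partial>M)"
    by (intro nn_integral_cong indep_copies_nn_integral[OF assms(3,4)])
       (auto intro!: measurable_compose[OF measurable_Pair1'] measurable_space[of S M M] measurable_space[of T M M])
  also have "\<dots> = (\<integral>\<^sup>+z. F z \<partial>(M \<Otimes>\<^sub>M N)) * (\<integral>\<^sup>+z. G z \<partial>(M \<Otimes>\<^sub>M N))"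
    by (subst indep_copies_nn_integral[OF assms(1,2)]) (auto simp: N.nn_integral_fst)
  finally show "(\<integral>\<^sup>+z. F (map_prod S S' z) * G (map_prod T T' z) \<partial>(M \<Otimes>\<^sub>M N)) =
    (\<integral>\<^sup>+z. F z \<partial>(M \<Otimes>\<^sub>M N)) * (\<integral>\<^sup>+z. G z \<partial>(M \<Otimes>\<^sub>M N))" .
qed

text \<open>Splits the positions of all vertices at once, so that densities become multiplicative
  under tensor squares. The induction takes out one coordinate at a time by Tonelli.\<close>

lemma indep_copies_PiM:
  assumes copies: "indep_copies M S T" and "sigma_finite_measure M" and "finite I"
  shows "indep_copies (PiM I (\<lambda>_. M)) (\<lambda>x. \<lambda>i\<in>I. S (x i)) (\<lambda>x. \<lambda>i\<in>I. T (x i))"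
  using \<open>finite I\<close>
proof (induction I)
  interpret product_sigma_finite "\<lambda>_. M"
    using assms(2) by (simp add: product_sigma_finite_def)
  have [measurable]: "S \<in> measurable M M" "T \<in> measurable M M"
    using assms by (auto simp: indep_copies_def)
  have meas: "(\<lambda>x. \<lambda>i\<in>I. S (x i)) \<in> measurable (PiM I (\<lambda>_. M)) (PiM I (\<lambda>_. M))"
    "(\<lambda>x. \<lambda>i\<in>I. T (x i)) \<in> measurable (PiM I (\<lambda>_. M)) (PiM I (\<lambda>_. M))" for I :: "'b set"
    by measurable
  {
    case empty
    show ?case
      by (rule indep_copiesI[OF sigma_finite meas]) (simp_all add: PiM_empty nn_integral_count_space_finite)
  next
    case (insert j I)
    let ?P = "\<lambda>I. PiM I (\<lambda>_. M)" let ?r = "\<lambda>I S x. \<lambda>i\<in>I. S (x i)"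
    interpret P: sigma_finite_measure "?P I"
      by (rule sigma_finite) fact
    show ?case
    proof (rule indep_copiesI[OF sigma_finite meas])
      fix F G :: "('b \<Rightarrow> 'a) \<Rightarrow> ennreal"
      assume [measurable]: "F \<in> borel_measurable (?P (insert j I))" "G \<in> borel_measurable (?P (insert j I))"
      have upd: "(\<lambda>x. F (x(j := s))) \<in> borel_measurable (?P I)"
        "(\<lambda>x. G (x(j := s))) \<in> borel_measurable (?P I)" if [measurable]: "s \<in> space M" for s
        by measurable
      have r_upd: "?r (insert j I) R (x(j := s)) = (?r I R x)(j := R s)" for R :: "'a \<Rightarrow> 'a" and x s
        using insert by (auto simp: restrict_def)
      have "(\<integral>\<^sup>+x. F (?r (insert j I) S x) * G (?r (insert j I) T x) \<partial>?P (insert j I)) =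
          (\<integral>\<^sup>+s. \<integral>\<^sup>+x. F (?r (insert j I) S (x(j := s))) * G (?r (insert j I) T (x(j := s))) \<partial>?P I \<partial>M)"
        by (rule product_nn_integral_insert_rev) (use insert meas in auto)
      also have "\<dots> = (\<integral>\<^sup>+s. \<integral>\<^sup>+x. F ((?r I S x)(j := S s)) * G ((?r I T x)(j := T s)) \<partial>?P I \<partial>M)"
        by (simp only: r_upd)
      \<comment> \<open>For fixed \<open>s\<close> the induction hypothesis separates
        \<open>F\<close> from \<open>G\<close> over the coordinates in \<open>I\<close>; the next
        step separates them in the coordinate \<open>j\<close>.\<close>
      also have "(\<integral>\<^sup>+s. \<integral>\<^sup>+x. F ((?r I S x)(j := S s)) * G ((?r I T x)(j := T s)) \<partial>?P I \<partial>M) =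
         (\<integral>\<^sup>+s. (\<integral>\<^sup>+x. F (x(j := S s)) \<partial>?P I) * (\<integral>\<^sup>+x. G (x(j := T s)) \<partial>?P I) \<partial>M)"
        by (intro nn_integral_cong indep_copies_nn_integral[OF insert.IH sigma_finite] upd insert
            measurable_space[of S M M] measurable_space[of T M M]) auto
      also have "\<dots> = (\<integral>\<^sup>+s. \<integral>\<^sup>+x. F (x(j := s)) \<partial>?P I \<partial>M) * (\<integral>\<^sup>+s. \<integral>\<^sup>+x. G (x(j := s)) \<partial>?P I \<partial>M)"
        by (rule indep_copies_nn_integral[OF copies assms(2)]) measurable
      also have "\<dots> = (\<integral>\<^sup>+x. F x \<partial>?P (insert j I)) * (\<integral>\<^sup>+x. G x \<partial>?P (insert j I))"
        using insert by (simp add: product_nn_integral_insert_rev)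
      finally show "(\<integral>\<^sup>+x. F (?r (insert j I) S x) * G (?r (insert j I) T x) \<partial>?P (insert j I)) =
        (\<integral>\<^sup>+x. F x \<partial>?P (insert j I)) * (\<integral>\<^sup>+x. G x \<partial>?P (insert j I))" .
    qed (use insert in auto)
  }
qed

section \<open>Conditional densities\<close>

abbreviation cube :: "'a set \<Rightarrow> ('a \<Rightarrow> real) measure" where
  "cube V \<equiv> PiM V (\<lambda>_. unit_measure)"

abbreviation unit_square :: "(real \<times> real) measure" where
  "unit_square \<equiv> unit_measure \<Otimes>\<^sub>M unit_measure"

interpretation unit_square: pair_prob_space unit_measure unit_measure ..

interpretation cubes: product_sigma_finite "\<lambda>_. unit_measure"
  by standard

interpretation cube: prob_space "cube V"
  by (rule prob_space_PiM) (rule unit_measure.prob_space_axioms)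

lemma space_cube: "x \<in> space (cube V) \<Longrightarrow> x \<in> V \<rightarrow> {0..1}"
  by (auto simp: space_PiM)

lemma space_unit_square [simp]: "space unit_square = {0..1} \<times> {0..1}"
  by (simp add: space_pair_measure)

section \<open>Edge sets and edge weights\<close>

definition edges_on :: "'a set \<Rightarrow> 'a set set \<Rightarrow> bool" where
  "edges_on V E \<longleftrightarrow> (\<forall>e\<in>E. \<exists>u\<in>V. \<exists>v\<in>V. e = {u, v})"

lemma edges_onE:
  assumes "edges_on V E" "e \<in> E"
  obtains u v where "u \<in> V" "v \<in> V" "e = {u, v}"
  using assms by (auto simp: edges_on_def)

lemma edges_on_Un: "edges_on V E \<Longrightarrow> edges_on V' E' \<Longrightarrow> edges_on (V \<union> V') (E \<union> E')"
  unfolding edges_on_def by (metis Un_iff)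

lemma edges_on_subset: "edges_on V E \<Longrightarrow> E \<subseteq> Pow V"
  by (auto simp: edges_on_def)

lemma finite_edges_on: "finite V \<Longrightarrow> edges_on V E \<Longrightarrow> finite E"
  using finite_subset[OF edges_on_subset] by blast

lemma graphonD:
  assumes "graphon W" "x \<in> {0..1}" "y \<in> {0..1}"
  shows "W x y = W y x" "0 \<le> W x y" "W x y \<le> 1"
  using assms by (auto simp: graphon_def)

lemma graphon_measurable [measurable_dest]:
  "graphon W \<Longrightarrow> case_prod W \<in> borel_measurable unit_square"
  by (simp add: graphon_def)

lemma edge_weight_graphon:
  assumes "graphon W" "x u \<in> {0..1}" "x v \<in> {0..1}"
  shows "edge_weight W x {u, v} = W (x u) (x v)"
  using assms by (intro edge_weight_eq graphonD)

text \<open>Every way of writing \<open>e\<close> as a pair evaluates the assignment on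
  \<open>e\<close> only, so the two definite descriptions have the same defining property.\<close>

lemma edge_weight_cong:
  assumes "\<And>w. w \<in> e \<Longrightarrow> x w = y w"
  shows "edge_weight W x e = edge_weight W y e"
proof -
  have "W (x u) (x v) = W (y u) (y v)" if "e = {u, v}" for u v
    using assms that by simp
  hence "(\<exists>u v. e = {u, v} \<and> r = W (x u) (x v)) \<longleftrightarrow> (\<exists>u v. e = {u, v} \<and> r = W (y u) (y v))" for r
    by metis
  thus ?thesis by (simp add: edge_weight_def)
qed

lemma edge_weight_bounds:
  assumes "graphon W" "edges_on V E" "e \<in> E" "x \<in> V \<rightarrow> {0..1}"
  shows "0 \<le> edge_weight W x e" "edge_weight W x e \<le> 1"
proof -
  obtain u v where uv: "u \<in> V" "v \<in> V" "e = {u, v}"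
    using assms by (auto elim: edges_onE)
  hence "x u \<in> {0..1}" "x v \<in> {0..1}"
    using assms by auto
  with uv show "0 \<le> edge_weight W x e" "edge_weight W x e \<le> 1"
    using assms by (simp_all add: edge_weight_graphon graphonD)
qed

lemma prod_edge_weight_bounds:
  assumes "graphon W" "edges_on V E" "x \<in> V \<rightarrow> {0..1}"
  shows "0 \<le> (\<Prod>e\<in>E. edge_weight W x e)" "(\<Prod>e\<in>E. edge_weight W x e) \<le> 1"
  using edge_weight_bounds[OF assms(1,2) _ assms(3)] by (auto intro!: prod_nonneg prod_le_1)

lemma measurable_prod_edge_weight:
  assumes "graphon W" "edges_on V E"
  shows "(\<lambda>x. \<Prod>e\<in>E. edge_weight W x e) \<in> borel_measurable (cube V)"
proof (rule borel_measurable_prod)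
  fix e assume "e \<in> E"
  then obtain u v where uv: "u \<in> V" "v \<in> V" "e = {u, v}"
    using assms by (auto elim: edges_onE)
  note [measurable] = graphon_measurable[OF assms(1)]
  have "(\<lambda>x. W (x u) (x v)) \<in> borel_measurable (cube V)"
    using uv by measurable
  \<comment> \<open>On the cube \<open>W\<close> is symmetric, so there the definite description
    \<open>edge_weight\<close> agrees with an explicitly measurable function.\<close>
  also have "?this \<longleftrightarrow> (\<lambda>x. edge_weight W x e) \<in> borel_measurable (cube V)"
    using uv assms(1) by (intro measurable_cong) (auto dest!: space_cube simp: edge_weight_graphon Pi_iff)
  finally show "(\<lambda>x. edge_weight W x e) \<in> borel_measurable (cube V)" .
qed

section \<open>Pinning the positions of two vertices\<close>

lemma measurable_pin:
  assumes "u \<in> V" "v \<in> V" "u \<noteq> v"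
  shows "(\<lambda>((s, t), z). z(u := s, v := t)) \<in> measurable (unit_square \<Otimes>\<^sub>M cube (V - {u, v})) (cube V)"
  unfolding case_prod_unfold
  by (rule measurable_fun_upd[where J = "V - {v}"], use assms in blast,
      rule measurable_fun_upd[where J = "V - {u, v}"]) (use assms in auto)

text \<open>A product measure is determined by its values on boxes, and the preimage of a box is a
  product of the two pinned sides and the box over the remaining vertices.\<close>

lemma distr_pin:
  assumes "finite V" "u \<in> V" "v \<in> V" "u \<noteq> v"
  shows "distr (unit_square \<Otimes>\<^sub>M cube (V - {u, v})) (cube V) (\<lambda>((s, t), z). z(u := s, v := t)) = cube V"
proof (rule cubes.PiM_eqI)
  let ?R = "V - {u, v}" let ?f = "\<lambda>((s, t), z). z(u := s, v := t) :: 'a \<Rightarrow> real"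
  fix A :: "'a \<Rightarrow> real set" assume A: "\<And>i. i \<in> V \<Longrightarrow> A i \<in> sets unit_measure"
  have A01: "A i \<subseteq> {0..1}" if "i \<in> V" for i
    using sets.sets_into_space[OF A[OF that]] by simp
  have V: "V = insert u (insert v ?R)" using assms by auto
  have "?f -` Pi\<^sub>E V A \<inter> space (unit_square \<Otimes>\<^sub>M cube ?R) = (A u \<times> A v) \<times> Pi\<^sub>E ?R A"
    (is "?L = ?Q")
  proof -
    have "q \<in> ?L \<longleftrightarrow> q \<in> ?Q" for q
    proof -
      obtain s t z where q: "q = ((s, t), z)"
        by (metis prod.collapse)
      show ?thesis
      proof
        assume "q \<in> ?L"
        hence *: "z(u := s, v := t) \<in> Pi\<^sub>E V A" "z \<in> space (cube ?R)"
          by (auto simp: q space_pair_measure)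
        have "z i \<in> A i" if "i \<in> ?R" for i
          using PiE_mem[OF *(1), of i] that by auto
        moreover have "s \<in> A u" "t \<in> A v"
          using PiE_mem[OF *(1), of u] PiE_mem[OF *(1), of v] assms by auto
        moreover have "z \<in> extensional ?R"
          using *(2) by (simp add: space_PiM PiE_def)
        ultimately show "q \<in> ?Q"
          by (simp add: q PiE_def Pi_def)
      next
        assume "q \<in> ?Q"
        hence *: "s \<in> A u" "t \<in> A v" "z \<in> Pi\<^sub>E ?R A"
          by (auto simp: q)
        have "z \<in> space (cube ?R)"
          using *(3) A01 unfolding space_PiM PiE_iff space_unit_measure by blast
        moreover have "s \<in> {0..1}" "t \<in> {0..1}"
          using * A01[of u] A01[of v] assms by auto
        moreover have "z(u := s, v := t) \<in> Pi\<^sub>E V A"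
          using * assms by (auto simp: PiE_iff extensional_def)
        ultimately show "q \<in> ?L"
          by (simp add: q space_pair_measure)
      qed
    qed
    thus ?thesis by blast
  qed
  hence "emeasure (distr (unit_square \<Otimes>\<^sub>M cube ?R) (cube V) ?f) (Pi\<^sub>E V A) =
      emeasure (unit_square \<Otimes>\<^sub>M cube ?R) ((A u \<times> A v) \<times> Pi\<^sub>E ?R A)"
    using assms A measurable_pin[of u V v]
    by (subst emeasure_distr) (auto intro!: sets_PiM_I_finite)
  also have "\<dots> = emeasure unit_measure (A u) * emeasure unit_measure (A v) *
      (\<Prod>i\<in>?R. emeasure unit_measure (A i))"
    using assms A cubes.emeasure_PiM[of ?R A]
    by (subst cube.emeasure_pair_measure_Times)
       (auto intro!: sets_PiM_I_finite simp: unit_measure.emeasure_pair_measure_Times)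
  also have "\<dots> = (\<Prod>i\<in>V. emeasure unit_measure (A i))"
    by (subst (2) V) (use assms in \<open>simp add: mult.assoc\<close>)
  finally show "emeasure (distr (unit_square \<Otimes>\<^sub>M cube ?R) (cube V) ?f) (Pi\<^sub>E V A) =
    (\<Prod>i\<in>V. emeasure unit_measure (A i))" .
qed (use assms in auto)

text \<open>Fubini's theorem with the positions of \<open>u\<close> and \<open>v\<close> as the
  outer variables.\<close>

lemma integral_cube_pin:
  fixes F :: "('a \<Rightarrow> real) \<Rightarrow> real"
  assumes "finite V" "u \<in> V" "v \<in> V" "u \<noteq> v" and F: "integrable (cube V) F"
  shows "(LINT x|cube V. F x) =
    (LINT p|unit_square. LINT z|cube (V - {u, v}). F (z(u := fst p, v := snd p)))"
proof -
  let ?R = "V - {u, v}" let ?f = "\<lambda>((s, t), z). z(u := s, v := t) :: 'a \<Rightarrow> real"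
  interpret pair_sigma_finite unit_square "cube ?R" ..
  note f [measurable] = measurable_pin[OF assms(2-4)]
  have "integrable (distr (unit_square \<Otimes>\<^sub>M cube ?R) (cube V) ?f) F"
    using F distr_pin[OF assms(1-4)] by simp
  hence int: "integrable (unit_square \<Otimes>\<^sub>M cube ?R) (\<lambda>q. F (?f q))"
    using F by (subst (asm) integrable_distr_eq) auto
  have "(LINT x|cube V. F x) = (LINT x|distr (unit_square \<Otimes>\<^sub>M cube ?R) (cube V) ?f. F x)"
    using distr_pin[OF assms(1-4)] by simp
  also have "\<dots> = (LINT q|(unit_square \<Otimes>\<^sub>M cube ?R). F (?f q))"
    using F by (subst integral_distr) auto
  also have "\<dots> = (LINT p|unit_square. LINT z|cube ?R. F (?f (p, z)))"
    by (rule integral_fst'[OF int, symmetric])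
  finally show ?thesis
    by (simp add: case_prod_unfold)
qed

text \<open>The function \<open>f\<^sub>i\<close> of the introductory outline.\<close>

definition link_density ::
    "'a set \<Rightarrow> 'a set set \<Rightarrow> 'a \<Rightarrow> 'a \<Rightarrow> (real \<Rightarrow> real \<Rightarrow> real) \<Rightarrow> real \<Rightarrow> real \<Rightarrow> real" where
  "link_density V E u v W s t =
     (LINT z|cube (V - {u, v}). (\<Prod>e\<in>E - {{u, v}}. edge_weight W (z(u := s, v := t)) e))"

lemma measurable_link_density:
  assumes "graphon W" "edges_on V E" "u \<in> V" "v \<in> V" "u \<noteq> v"
  shows "case_prod (link_density V E u v W) \<in> borel_measurable unit_square"
proof -
  have "edges_on V (E - {{u, v}})"
    using assms by (auto simp: edges_on_def)
  note measurable_compose[OF measurable_pin[OF assms(3-5)] measurable_prod_edge_weight[OF assms(1) this]]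
  thus ?thesis
    unfolding link_density_def case_prod_unfold
    by (intro cube.borel_measurable_lebesgue_integral) (simp add: case_prod_unfold)
qed

lemma pin_in_cube:
  assumes "z \<in> space (cube (V - {u, v}))" "s \<in> {0..1}" "t \<in> {0..1}"
  shows "z(u := s, v := t) \<in> V \<rightarrow> {0..1}"
  using space_cube[OF assms(1)] assms(2,3) by (auto simp: Pi_iff)

lemma link_density_bounds:
  assumes "graphon W" "edges_on V E" "u \<in> V" "v \<in> V" "u \<noteq> v" "s \<in> {0..1}" "t \<in> {0..1}"
  shows "0 \<le> link_density V E u v W s t" "link_density V E u v W s t \<le> 1"
proof -
  have E: "edges_on V (E - {{u, v}})"
    using assms by (auto simp: edges_on_def)
  have pin: "(\<lambda>z. z(u := s, v := t)) \<in> measurable (cube (V - {u, v})) (cube V)"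
    using measurable_compose[OF measurable_Pair1'[of "(s, t)"] measurable_pin[OF assms(3-5)]] assms
    by simp
  note b = prod_edge_weight_bounds[OF assms(1) E pin_in_cube[OF _ assms(6,7)]]
  have int: "integrable (cube (V - {u, v})) (\<lambda>z. \<Prod>e\<in>E - {{u, v}}. edge_weight W (z(u := s, v := t)) e)"
    using b measurable_compose[OF pin measurable_prod_edge_weight[OF assms(1) E]]
    by (intro cube.integrable_const_bound[where B = 1]) auto
  show "0 \<le> link_density V E u v W s t"
    unfolding link_density_def using b by (intro integral_nonneg_AE) auto
  show "link_density V E u v W s t \<le> 1"
    unfolding link_density_def using b by (intro cube.integral_le_const int) auto
qed

text \<open>Once \<open>u\<close> and \<open>v\<close> are pinned, the remaining vertices of the two
  graphs form disjoint sets \<open>R1\<close> and \<open>R2\<close> with no edge between them. The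
  integrand therefore splits into the weight of the shared edge and two factors in separate
  variables.\<close>

lemma glued_density_eq_integral_link:
  fixes V1 V2 :: "'a set"
  assumes "graphon W" "finite V1" "finite V2" "edges_on V1 E1" "edges_on V2 E2" "u \<noteq> v"
    and V: "V1 \<inter> V2 = {u, v}" and E: "E1 \<inter> E2 = {{u, v}}"
  shows "(LINT x|cube (V1 \<union> V2). (\<Prod>e\<in>E1 \<union> E2. edge_weight W x e)) =
    (LINT (s, t)|unit_square. W s t * link_density V1 E1 u v W s t * link_density V2 E2 u v W s t)"
proof -
  define R1 R2 where "R1 = V1 - {u, v}" and "R2 = V2 - {u, v}"
  have R: "V1 \<union> V2 - {u, v} = R1 \<union> R2" "R1 \<inter> R2 = {}" "finite R1" "finite R2"
    unfolding R1_def R2_def using V assms(2,3) by (blast, blast, simp_all)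
  have "u \<in> V1 \<inter> V2" "v \<in> V1 \<inter> V2"
    by (simp_all add: V)
  hence uv: "u \<in> V1 \<union> V2" "v \<in> V1 \<union> V2"
    by simp_all
  have EE: "edges_on (V1 \<union> V2) (E1 \<union> E2)"
    by (rule edges_on_Un) fact+
  have fin: "finite E1" "finite E2" "finite (V1 \<union> V2)" 
    using assms(2-5) by (simp_all add: finite_edges_on)
  have int: "integrable (cube (V1 \<union> V2)) (\<lambda>x. \<Prod>e\<in>E1 \<union> E2. edge_weight W x e)"
    using prod_edge_weight_bounds[OF assms(1) EE space_cube] measurable_prod_edge_weight[OF assms(1) EE]
    by (intro cube.integrable_const_bound[where B = 1]) auto
  \<comment> \<open>The shared edge occurs once in the union, which is why \<open>W\<close> enters
    only to the first power.\<close>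
  have split: "(\<Prod>e\<in>E1 \<union> E2. g e) = g {u, v} * ((\<Prod>e\<in>E1 - {{u, v}}. g e) * (\<Prod>e\<in>E2 - {{u, v}}. g e))"
    for g :: "'a set \<Rightarrow> real"
  proof -
    have "E1 \<union> E2 = insert {u, v} ((E1 - {{u, v}}) \<union> (E2 - {{u, v}}))"
      using E by auto
    moreover have "(E1 - {{u, v}}) \<inter> (E2 - {{u, v}}) = {}"
      using E by auto
    ultimately show ?thesis
      using fin by (simp add: prod.union_disjoint)
  qed
  define F where "F E p z = (\<Prod>e\<in>E - {{u, v}}. edge_weight W (z(u := fst p, v := snd p)) e)"
    for E and p :: "real \<times> real" and z :: "'a \<Rightarrow> real"
  have "(LINT x|cube (V1 \<union> V2). (\<Prod>e\<in>E1 \<union> E2. edge_weight W x e)) =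
    (LINT p|unit_square. LINT z|cube (R1 \<union> R2). (\<Prod>e\<in>E1 \<union> E2. edge_weight W (z(u := fst p, v := snd p)) e))"
    using integral_cube_pin[OF fin(3) uv assms(6) int] by (simp add: R)
  also have "\<dots> = (LINT p|unit_square. LINT z|cube (R1 \<union> R2). W (fst p) (snd p) * (F E1 p z * F E2 p z))"
    using assms(6) unfolding split F_def
    by (intro Bochner_Integration.integral_cong refl) (auto simp: edge_weight_graphon[OF assms(1)])
  also have "\<dots> = (LINT p|unit_square. W (fst p) (snd p) * ((LINT z|cube R1. F E1 p z) * (LINT z|cube R2. F E2 p z)))"
  proof (rule Bochner_Integration.integral_cong[OF refl])
    fix p assume "p \<in> space unit_square"
    then obtain s t where p: "p = (s, t)" "s \<in> {0..1}" "t \<in> {0..1}" by auto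
    have pin: "(\<lambda>z. z(u := s, v := t)) \<in> measurable (cube (R1 \<union> R2)) (cube (V1 \<union> V2))"
      using measurable_compose[OF measurable_Pair1'[of "(s, t)"] measurable_pin[OF uv assms(6)]] p R(1) by simp
    have E': "edges_on (V1 \<union> V2) ((E1 - {{u, v}}) \<union> (E2 - {{u, v}}))"
      using EE by (auto simp: edges_on_def)
    have FF: "F E1 p z * F E2 p z = (\<Prod>e\<in>(E1 - {{u, v}}) \<union> (E2 - {{u, v}}). edge_weight W (z(u := s, v := t)) e)" for z
      unfolding F_def p fst_conv snd_conv using E fin by (intro prod.union_disjoint[symmetric]) auto
    have int: "integrable (cube (R1 \<union> R2)) (\<lambda>z. F E1 p z * F E2 p z)"
      unfolding FF using measurable_compose[OF pin measurable_prod_edge_weight[OF assms(1) E']]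
      using prod_edge_weight_bounds[OF assms(1) E' pin_in_cube[OF _ p(2,3)]] R(1)
      by (intro cube.integrable_const_bound[where B = 1]) auto
    have F1: "F E1 p (merge R1 R2 (x, y)) = F E1 p x" for x y
      unfolding F_def
    proof (intro prod.cong edge_weight_cong refl)
      fix e w assume "e \<in> E1 - {{u, v}}" "w \<in> e"
      hence "w \<in> V1" using assms(4) by (auto simp: edges_on_def)
      thus "((merge R1 R2 (x, y))(u := fst p, v := snd p)) w = (x(u := fst p, v := snd p)) w"
        by (auto simp: R1_def merge_def)
    qed
    \<comment> \<open>\<open>merge\<close> gives precedence to \<open>R1\<close>, so it matters that
      an unpinned vertex of \<open>V2\<close> lies outside \<open>R1\<close>.\<close>
    have F2: "F E2 p (merge R1 R2 (x, y)) = F E2 p y" for x y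
      unfolding F_def
    proof (intro prod.cong edge_weight_cong refl)
      fix e w assume "e \<in> E2 - {{u, v}}" "w \<in> e"
      hence "w \<in> V2" using assms(5) by (auto simp: edges_on_def)
      hence "w \<in> {u, v} \<or> w \<in> R2 \<and> w \<notin> R1" using V by (auto simp: R1_def R2_def)
      thus "((merge R1 R2 (x, y))(u := fst p, v := snd p)) w = (y(u := fst p, v := snd p)) w"
        by (auto simp: merge_def)
    qed
    have "(LINT z|cube (R1 \<union> R2). F E1 p z * F E2 p z) =
       (LINT x|cube R1. LINT y|cube R2. F E1 p x * F E2 p y)"
      by (subst cubes.product_integral_fold[OF R(2,3,4) int]) (simp add: F1 F2)
    thus "(LINT z|cube (R1 \<union> R2). W (fst p) (snd p) * (F E1 p z * F E2 p z)) =
      W (fst p) (snd p) * ((LINT z|cube R1. F E1 p z) * (LINT z|cube R2. F E2 p z))"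
      by simp
  qed
  finally show ?thesis
    by (simp add: link_density_def F_def R1_def R2_def case_prod_unfold mult_ac)
qed

section \<open>Tensor squares\<close>

text \<open>This class is wide enough for link densities, which may be asymmetric, and for
  logarithms, which may be negative.\<close>

definition bdd_kernel :: "(real \<Rightarrow> real \<Rightarrow> real) \<Rightarrow> bool" where
  "bdd_kernel F \<longleftrightarrow> case_prod F \<in> borel_measurable unit_square \<and>
     (\<exists>C. \<forall>s\<in>{0..1}. \<forall>t\<in>{0..1}. \<bar>F s t\<bar> \<le> C)"

text \<open>The uniform lower bound keeps both \<open>ln F\<close> and \<open>1 / F\<close>
  bounded.\<close>

definition pos_kernel :: "(real \<Rightarrow> real \<Rightarrow> real) \<Rightarrow> bool" where
  "pos_kernel F \<longleftrightarrow> bdd_kernel F \<and> (\<exists>c>0. \<forall>s\<in>{0..1}. \<forall>t\<in>{0..1}. c \<le> F s t)"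

abbreviation square_integral :: "(real \<Rightarrow> real \<Rightarrow> real) \<Rightarrow> real" where
  "square_integral F \<equiv> (LINT p|unit_square. case_prod F p)"

lemma bdd_kernelI:
  assumes "case_prod F \<in> borel_measurable unit_square"
    and "\<And>s t. s \<in> {0..1} \<Longrightarrow> t \<in> {0..1} \<Longrightarrow> \<bar>F s t\<bar> \<le> C"
  shows "bdd_kernel F"
  using assms unfolding bdd_kernel_def by blast

lemma bdd_kernel_measurable [measurable_dest]: "bdd_kernel F \<Longrightarrow> case_prod F \<in> borel_measurable unit_square"
  by (simp add: bdd_kernel_def)

lemma bdd_kernel_const: "bdd_kernel (\<lambda>_ _. c)"
  by (rule bdd_kernelI[of _ "\<bar>c\<bar>"]) auto

lemma bdd_kernel_graphon: "graphon W \<Longrightarrow> bdd_kernel W"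
  by (rule bdd_kernelI[of _ 1]) (auto simp: graphon_def)

lemma bdd_kernel_add:
  assumes F: "bdd_kernel F" and G: "bdd_kernel G"
  shows "bdd_kernel (\<lambda>s t. F s t + G s t)"
proof -
  obtain C where "\<And>s t. s \<in> {0..1} \<Longrightarrow> t \<in> {0..1} \<Longrightarrow> \<bar>F s t\<bar> \<le> C"
    using F unfolding bdd_kernel_def by blast
  moreover obtain D where "\<And>s t. s \<in> {0..1} \<Longrightarrow> t \<in> {0..1} \<Longrightarrow> \<bar>G s t\<bar> \<le> D"
    using G unfolding bdd_kernel_def by blast
  ultimately show ?thesis
    using bdd_kernel_measurable[OF F] bdd_kernel_measurable[OF G]
    by (intro bdd_kernelI[of _ "C + D"]) (auto intro!: order.trans[OF abs_triangle_ineq] add_mono)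
qed

lemma bdd_kernel_mult:
  assumes F: "bdd_kernel F" and G: "bdd_kernel G"
  shows "bdd_kernel (\<lambda>s t. F s t * G s t)"
proof -
  obtain C where C: "\<And>s t. s \<in> {0..1} \<Longrightarrow> t \<in> {0..1} \<Longrightarrow> \<bar>F s t\<bar> \<le> C"
    using F unfolding bdd_kernel_def by blast
  moreover have "0 \<le> C"
    using C[of 0 0] by simp
  moreover obtain D where "\<And>s t. s \<in> {0..1} \<Longrightarrow> t \<in> {0..1} \<Longrightarrow> \<bar>G s t\<bar> \<le> D"
    using G unfolding bdd_kernel_def by blast
  ultimately show ?thesis
    using bdd_kernel_measurable[OF F] bdd_kernel_measurable[OF G]
    by (intro bdd_kernelI[of _ "C * D"]) (auto simp: abs_mult intro!: mult_mono)
qed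

lemma bdd_kernel_power2: "bdd_kernel F \<Longrightarrow> bdd_kernel (\<lambda>s t. (F s t)\<^sup>2)"
  unfolding power2_eq_square by (rule bdd_kernel_mult)

lemma bdd_kernel_diff: "bdd_kernel F \<Longrightarrow> bdd_kernel G \<Longrightarrow> bdd_kernel (\<lambda>s t. F s t - G s t)"
  using bdd_kernel_add[OF _ bdd_kernel_mult[OF bdd_kernel_const[of "-1"]], of F G] by simp

lemma bdd_kernel_pullback:
  assumes F: "bdd_kernel F" and [measurable]: "\<phi> \<in> measurable unit_measure unit_measure"
  shows "bdd_kernel (\<lambda>s t. F (\<phi> s) (\<phi> t))"
proof -
  obtain C where C: "\<And>s t. s \<in> {0..1} \<Longrightarrow> t \<in> {0..1} \<Longrightarrow> \<bar>F s t\<bar> \<le> C"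
    using \<open>bdd_kernel F\<close> unfolding bdd_kernel_def by blast
  have "\<phi> s \<in> {0..1}" if "s \<in> {0..1}" for s
    using measurable_space[OF assms(2), of s] that by simp
  with C show ?thesis
    using bdd_kernel_measurable[OF F] by (intro bdd_kernelI[of _ C]) auto
qed

lemma bdd_kernel_swap: "bdd_kernel F \<Longrightarrow> bdd_kernel (\<lambda>s t. F t s)"
  using measurable_pair_swap[of "case_prod F" unit_measure unit_measure borel]
  by (auto simp: bdd_kernel_def case_prod_unfold)

lemma pos_kernelI:
  assumes "bdd_kernel F" "0 < c" "\<And>s t. s \<in> {0..1} \<Longrightarrow> t \<in> {0..1} \<Longrightarrow> c \<le> F s t"
  shows "pos_kernel F"
  using assms unfolding pos_kernel_def by blast

lemma pos_kernelE:
  assumes "pos_kernel F"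
  obtains c where "0 < c" "\<And>s t. s \<in> {0..1} \<Longrightarrow> t \<in> {0..1} \<Longrightarrow> c \<le> F s t"
  using assms unfolding pos_kernel_def by blast

lemma pos_kernel_pos: "pos_kernel F \<Longrightarrow> s \<in> {0..1} \<Longrightarrow> t \<in> {0..1} \<Longrightarrow> 0 < F s t"
  by (erule pos_kernelE) force

lemma pos_kernel_kernel: "pos_kernel F \<Longrightarrow> bdd_kernel F"
  by (simp add: pos_kernel_def)

lemma pos_kernel_mult:
  assumes F: "pos_kernel F" and G: "pos_kernel G"
  shows "pos_kernel (\<lambda>s t. F s t * G s t)"
proof -
  obtain c where c: "0 < c" "\<And>s t. s \<in> {0..1} \<Longrightarrow> t \<in> {0..1} \<Longrightarrow> c \<le> F s t"
    using F unfolding pos_kernel_def by blast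
  obtain d where d: "0 < d" "\<And>s t. s \<in> {0..1} \<Longrightarrow> t \<in> {0..1} \<Longrightarrow> d \<le> G s t"
    using G unfolding pos_kernel_def by blast
  show ?thesis
  proof (rule pos_kernelI)
    show "c * d \<le> F s t * G s t" if "s \<in> {0..1}" "t \<in> {0..1}" for s t
      using c(1) c(2)[OF that] d(1) d(2)[OF that] by (intro mult_mono) auto
    show "0 < c * d" using c d by simp
  qed (intro bdd_kernel_mult pos_kernel_kernel assms)
qed

lemma pos_kernel_pullback:
  assumes F: "pos_kernel F" and \<phi>: "\<phi> \<in> measurable unit_measure unit_measure"
  shows "pos_kernel (\<lambda>s t. F (\<phi> s) (\<phi> t))"
proof -
  obtain c where c: "0 < c" "\<And>s t. s \<in> {0..1} \<Longrightarrow> t \<in> {0..1} \<Longrightarrow> c \<le> F s t"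
    using assms unfolding pos_kernel_def by blast
  have "\<phi> s \<in> {0..1}" if "s \<in> {0..1}" for s
    using measurable_space[OF \<phi>, of s] that by simp
  with c show ?thesis
    using bdd_kernel_pullback[OF pos_kernel_kernel[OF F] \<phi>] by (intro pos_kernelI[of _ c]) auto
qed

lemma pos_kernel_inverse:
  assumes "pos_kernel F"
  shows "bdd_kernel (\<lambda>s t. 1 / F s t)"
proof -
  obtain c where c: "0 < c" "\<And>s t. s \<in> {0..1} \<Longrightarrow> t \<in> {0..1} \<Longrightarrow> c \<le> F s t"
    using assms unfolding pos_kernel_def by blast
  note [measurable] = bdd_kernel_measurable[OF pos_kernel_kernel[OF assms]]
  show ?thesis
  proof (rule bdd_kernelI)
    fix s t :: real assume "s \<in> {0..1}" "t \<in> {0..1}"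
    with c show "\<bar>1 / F s t\<bar> \<le> 1 / c" by (auto simp: frac_le pos_kernel_pos[OF assms] less_imp_le)
  qed measurable
qed

lemma pos_kernel_ln:
  assumes "pos_kernel F"
  shows "bdd_kernel (\<lambda>s t. ln (F s t))"
proof -
  obtain c where c: "0 < c" "\<And>s t. s \<in> {0..1} \<Longrightarrow> t \<in> {0..1} \<Longrightarrow> c \<le> F s t"
    using assms unfolding pos_kernel_def by blast
  obtain C where C: "\<And>s t. s \<in> {0..1} \<Longrightarrow> t \<in> {0..1} \<Longrightarrow> \<bar>F s t\<bar> \<le> C"
    using pos_kernel_kernel[OF assms] unfolding bdd_kernel_def by blast
  note [measurable] = bdd_kernel_measurable[OF pos_kernel_kernel[OF assms]]
  show ?thesis
  proof (rule bdd_kernelI)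
    fix s t :: real assume st: "s \<in> {0..1}" "t \<in> {0..1}"
    have "ln c \<le> ln (F s t)" "ln (F s t) \<le> ln C"
      using c(1) c(2)[OF st] C[OF st] by (auto intro!: ln_mono)
    thus "\<bar>ln (F s t)\<bar> \<le> \<bar>ln c\<bar> + \<bar>ln C\<bar>" by linarith
  qed measurable
qed

lemma integrable_kernel:
  assumes "bdd_kernel F"
  shows "integrable unit_square (case_prod F)"
proof -
  obtain C where "\<And>s t. s \<in> {0..1} \<Longrightarrow> t \<in> {0..1} \<Longrightarrow> \<bar>F s t\<bar> \<le> C"
    using \<open>bdd_kernel F\<close> unfolding bdd_kernel_def by blast
  thus ?thesis
    using assms by (intro unit_square.P.integrable_const_bound[where B = C]) auto
qed

lemma square_integral_add:
  assumes "bdd_kernel F" "bdd_kernel G"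
  shows "square_integral (\<lambda>s t. F s t + G s t) = square_integral F + square_integral G"
  using Bochner_Integration.integral_add[OF assms[THEN integrable_kernel]]
  by (simp add: case_prod_unfold)

lemma square_integral_diff:
  assumes "bdd_kernel F" "bdd_kernel G"
  shows "square_integral (\<lambda>s t. F s t - G s t) = square_integral F - square_integral G"
  using Bochner_Integration.integral_diff[OF assms[THEN integrable_kernel]]
  by (simp add: case_prod_unfold)

lemma square_integral_cmult:
  "square_integral (\<lambda>s t. c * F s t) = c * square_integral F"
  using integral_mult_right_zero[of unit_square c "case_prod F"] by (simp add: case_prod_unfold)

lemma square_integral_mono:
  assumes "bdd_kernel F" "bdd_kernel G" "\<And>s t. s \<in> {0..1} \<Longrightarrow> t \<in> {0..1} \<Longrightarrow> F s t \<le> G s t"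
  shows "square_integral F \<le> square_integral G"
  using assms by (intro integral_mono integrable_kernel) auto

lemma square_integral_cong:
  assumes "\<And>s t. s \<in> {0..1} \<Longrightarrow> t \<in> {0..1} \<Longrightarrow> F s t = G s t"
  shows "square_integral F = square_integral G"
  using assms by (intro Bochner_Integration.integral_cong) auto

lemma square_integral_swap:
  assumes "bdd_kernel F"
  shows "square_integral (\<lambda>s t. F t s) = square_integral F"
  using unit_square.integral_product_swap[of "case_prod F"] bdd_kernel_measurable[OF assms]
  by (simp add: case_prod_unfold)

text \<open>An unnormalised expectation of \<open>h\<close> at the positions of \<open>u\<close> and
  \<open>v\<close>. As an integral over the whole cube it is multiplicative under tensor squares, so
  the choice \<open>h = 1 / g\<close> carries the needed information about the link density through
  all tensor powers.\<close>

definition weighted_density ::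
    "'a set \<Rightarrow> 'a set set \<Rightarrow> 'a \<Rightarrow> 'a \<Rightarrow> (real \<Rightarrow> real \<Rightarrow> real) \<Rightarrow> (real \<Rightarrow> real \<Rightarrow> real) \<Rightarrow> real" where
  "weighted_density V E u v W h = (LINT x|cube V. (\<Prod>e\<in>E. edge_weight W x e) * h (x u) (x v))"

lemma integrable_weighted_density:
  assumes "graphon W" "edges_on V E" "u \<in> V" "v \<in> V" "bdd_kernel h"
  shows "integrable (cube V) (\<lambda>x. (\<Prod>e\<in>E. edge_weight W x e) * h (x u) (x v))"
proof -
  obtain C where C: "\<And>s t. s \<in> {0..1} \<Longrightarrow> t \<in> {0..1} \<Longrightarrow> \<bar>h s t\<bar> \<le> C"
    using \<open>bdd_kernel h\<close> unfolding bdd_kernel_def by blast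
  note [measurable] = bdd_kernel_measurable[OF assms(5)] measurable_prod_edge_weight[OF assms(1,2)]
  show ?thesis
  proof (rule cube.integrable_const_bound[where B = C])
    show "AE x in cube V. norm ((\<Prod>e\<in>E. edge_weight W x e) * h (x u) (x v)) \<le> C"
    proof (rule AE_I2)
      fix x assume "x \<in> space (cube V)"
      hence x: "x \<in> V \<rightarrow> {0..1}" by (rule space_cube)
      hence "\<bar>h (x u) (x v)\<bar> \<le> C" using assms(3,4) by (intro C) auto
      with prod_edge_weight_bounds[OF assms(1,2) x]
      show "norm ((\<Prod>e\<in>E. edge_weight W x e) * h (x u) (x v)) \<le> C"
        using mult_left_le_one_le[of "\<bar>h (x u) (x v)\<bar>" "\<Prod>e\<in>E. edge_weight W x e"]
        by (simp add: abs_mult)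
    qed
  qed (use assms(3,4) in measurable)
qed

section \<open>Splitting a point of the unit interval into two independent points\<close>

locale unit_split =
  fixes \<phi> \<psi> :: "real \<Rightarrow> real"
  assumes copies: "indep_copies unit_measure \<phi> \<psi>"
begin

lemma measurable_split [measurable]:
  "\<phi> \<in> measurable unit_measure unit_measure" "\<psi> \<in> measurable unit_measure unit_measure"
  using copies by (auto simp: indep_copies_def)

lemma split_in_unit: "s \<in> {0..1} \<Longrightarrow> \<phi> s \<in> {0..1}" "s \<in> {0..1} \<Longrightarrow> \<psi> s \<in> {0..1}"
  using measurable_split[THEN measurable_space] by auto

text \<open>A tensor square naturally lives on pairs of points of the unit square. The split brings
  it back to the unit interval, so that Sidorenko's inequality can be applied to it.\<close>

definition tensor_square :: "(real \<Rightarrow> real \<Rightarrow> real) \<Rightarrow> real \<Rightarrow> real \<Rightarrow> real" where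
  "tensor_square W s t = W (\<phi> s) (\<phi> t) * W (\<psi> s) (\<psi> t)"

text \<open>For independent uniform \<open>s\<close> and \<open>t\<close>, the four points
  \<open>\<phi> s\<close>, \<open>\<psi> s\<close>, \<open>\<phi> t\<close>, \<open>\<psi> t\<close>
  are independent and uniform. Different kernels \<open>F\<close> and \<open>G\<close> are allowed
  for the mixed terms in the moment computations.\<close>

lemma square_integral_tensor:
  assumes "bdd_kernel F" "bdd_kernel G"
  shows "square_integral (\<lambda>s t. F (\<phi> s) (\<phi> t) * G (\<psi> s) (\<psi> t)) = square_integral F * square_integral G"
  using indep_copies_integral(2)[OF indep_copies_pair[OF copies _ copies] _
      assms[THEN integrable_kernel]] unit_measure.sigma_finite_measure_axioms
    unit_square.P.sigma_finite_measure_axioms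
  by (simp add: case_prod_unfold)

lemma bdd_kernel_tensor:
  assumes "bdd_kernel F" "bdd_kernel G"
  shows "bdd_kernel (\<lambda>s t. F (\<phi> s) (\<phi> t) * G (\<psi> s) (\<psi> t))"
  by (rule bdd_kernel_mult[OF bdd_kernel_pullback[OF assms(1) measurable_split(1)]
        bdd_kernel_pullback[OF assms(2) measurable_split(2)]])

lemma graphon_tensor_square:
  assumes "graphon W"
  shows "graphon (tensor_square W)"
  unfolding graphon_def
proof (intro conjI ballI)
  show "case_prod (tensor_square W) \<in> borel_measurable unit_square"
    unfolding tensor_square_def
    by (rule bdd_kernel_measurable[OF bdd_kernel_tensor[OF assms[THEN bdd_kernel_graphon] assms[THEN bdd_kernel_graphon]]])
  fix x y :: real assume "x \<in> {0..1}" "y \<in> {0..1}"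
  note xy = split_in_unit[OF this(1)] split_in_unit[OF this(2)]
  show "tensor_square W x y = tensor_square W y x"
    using graphonD(1)[OF assms xy(1,3)] graphonD(1)[OF assms xy(2,4)] by (simp add: tensor_square_def)
  show "tensor_square W x y \<in> {0..1}"
    using graphonD(2,3)[OF assms xy(1,3)] graphonD(2,3)[OF assms xy(2,4)]
    by (auto simp: tensor_square_def intro: mult_le_one)
qed

text \<open>Every vertex position splits into two independent positions, giving independent points
  \<open>S \<phi> x\<close> and \<open>S \<psi> x\<close> of the cube, and the integrand is the
  product of its values at these two points.\<close>

lemma weighted_density_tensor_square:
  assumes "graphon W" "finite V" "edges_on V E" "u \<in> V" "v \<in> V" "bdd_kernel h"
  shows "weighted_density V E u v (tensor_square W) (tensor_square h) = (weighted_density V E u v W h)\<^sup>2"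
proof -
  define S where "S \<phi> x = (\<lambda>i\<in>V. \<phi> (x i))" for \<phi> :: "real \<Rightarrow> real" and x :: "'a \<Rightarrow> real"
  define F where "F x = (\<Prod>e\<in>E. edge_weight W x e) * h (x u) (x v)" for x
  have "(\<Prod>e\<in>E. edge_weight (tensor_square W) x e) * tensor_square h (x u) (x v) = F (S \<phi> x) * F (S \<psi> x)"
    if "x \<in> space (cube V)" for x
  proof -
    have "edge_weight (tensor_square W) x e = edge_weight W (S \<phi> x) e * edge_weight W (S \<psi> x) e"
      if e: "e \<in> E" for e
    proof -
      obtain a b where ab: "a \<in> V" "b \<in> V" "e = {a, b}"
        using edges_onE[OF assms(3) e] by blast
      hence x: "x a \<in> {0..1}" "x b \<in> {0..1}"
        using space_cube[OF \<open>x \<in> space (cube V)\<close>] by auto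
      show ?thesis
        using ab split_in_unit[OF x(1)] split_in_unit[OF x(2)]
        by (simp add: S_def edge_weight_graphon[OF assms(1)] tensor_square_def
            edge_weight_graphon[where x = x, OF graphon_tensor_square[OF assms(1)] x])
    qed
    hence "(\<Prod>e\<in>E. edge_weight (tensor_square W) x e) =
        (\<Prod>e\<in>E. edge_weight W (S \<phi> x) e) * (\<Prod>e\<in>E. edge_weight W (S \<psi> x) e)"
      by (simp add: prod.distrib)
    thus ?thesis
      using assms(4,5) by (simp add: F_def tensor_square_def) (simp add: S_def mult_ac)
  qed
  hence "weighted_density V E u v (tensor_square W) (tensor_square h) =
      (LINT x|cube V. F (S \<phi> x) * F (S \<psi> x))"
    unfolding weighted_density_def by (intro Bochner_Integration.integral_cong) auto
  also have "\<dots> = (LINT x|cube V. F x) * (LINT x|cube V. F x)"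
    unfolding S_def F_def
    by (intro indep_copies_integral indep_copies_PiM copies assms integrable_weighted_density
        unit_measure.sigma_finite_measure_axioms cube.sigma_finite_measure_axioms)
  finally show ?thesis
    by (simp add: weighted_density_def F_def power2_eq_square)
qed

end

section \<open>The logarithmic inequality\<close>

text \<open>With \<open>u\<close> and \<open>v\<close> pinned, the edge between them contributes
  \<open>W s t\<close> and the other edges integrate to the link density.\<close>

lemma weighted_density_eq:
  assumes "graphon W" "finite V" "edges_on V E" "{u, v} \<in> E" "u \<noteq> v" "bdd_kernel h"
  shows "weighted_density V E u v W h =
    square_integral (\<lambda>s t. W s t * link_density V E u v W s t * h s t)"
proof -
  have uv: "u \<in> V" "v \<in> V"
    using assms(3,4) by (auto simp: edges_on_def doubleton_eq_iff)
  have fin: "finite E"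
    using assms by (simp add: finite_edges_on)
  have "weighted_density V E u v W h =
    (LINT p|unit_square. LINT z|cube (V - {u, v}).
      (\<Prod>e\<in>E. edge_weight W (z(u := fst p, v := snd p)) e) * h (fst p) (snd p))"
    using integral_cube_pin[OF assms(2) uv assms(5) integrable_weighted_density[OF assms(1,3) uv assms(6)]]
      assms(5) by (simp add: weighted_density_def)
  also have "\<dots> = (LINT p|unit_square. LINT z|cube (V - {u, v}).
      W (fst p) (snd p) * h (fst p) (snd p) *
      (\<Prod>e\<in>E - {{u, v}}. edge_weight W (z(u := fst p, v := snd p)) e))"
    using assms(5)
    by (intro Bochner_Integration.integral_cong refl)
       (auto simp: prod.remove[OF fin assms(4)] edge_weight_graphon[OF assms(1)])
  finally show ?thesis
    by (simp add: link_density_def case_prod_unfold mult_ac)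
qed

text \<open>Under the probability density \<open>W / p\<close>, the random variable \<open>ln g\<close> has mean \<open>K\<close> and
  variance \<open>A / p\<close>.\<close>

definition concentrated ::
    "'a set \<Rightarrow> 'a set set \<Rightarrow> 'a \<Rightarrow> 'a \<Rightarrow> (real \<Rightarrow> real \<Rightarrow> real) \<Rightarrow> (real \<Rightarrow> real \<Rightarrow> real) \<Rightarrow>
     real \<Rightarrow> real \<Rightarrow> real \<Rightarrow> real \<Rightarrow> bool" where
  "concentrated V E u v W g p K A \<theta> \<longleftrightarrow> graphon W \<and> pos_kernel g \<and>
     square_integral W = p \<and>
     square_integral (\<lambda>s t. W s t * (ln (g s t) - K)) = 0 \<and>
     square_integral (\<lambda>s t. W s t * (ln (g s t) - K)\<^sup>2) = A \<and>
     weighted_density V E u v W (\<lambda>s t. 1 / g s t) = \<theta>"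

context unit_split
begin

text \<open>The logarithm of the tensor square of \<open>g\<close> is a sum of two independent
  copies of \<open>ln g\<close>, so mean and variance double. The variance is \<open>A / p\<close>
  and the total mass becomes \<open>p\<^sup>2\<close>, hence \<open>A\<close> becomes
  \<open>2 * p * A\<close>.\<close>

lemma concentrated_tensor_square:
  assumes "finite V" "edges_on V E" "u \<in> V" "v \<in> V" and conc: "concentrated V E u v W g p K A \<theta>"
  shows "concentrated V E u v (tensor_square W) (tensor_square g) (p\<^sup>2) (2 * K) (2 * p * A) (\<theta>\<^sup>2)"
proof -
  have W: "graphon W" and g: "pos_kernel g" and p: "square_integral W = p"
    and m1: "square_integral (\<lambda>s t. W s t * (ln (g s t) - K)) = 0"
    and m2: "square_integral (\<lambda>s t. W s t * (ln (g s t) - K)\<^sup>2) = A"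
    and \<theta>: "weighted_density V E u v W (\<lambda>s t. 1 / g s t) = \<theta>"
    using conc by (auto simp: concentrated_def)
  define c where "c s t = ln (g s t) - K" for s t
  define W1 W2 where "W1 s t = W s t * c s t" and "W2 s t = W s t * (c s t)\<^sup>2" for s t
  have kW: "bdd_kernel W" by (rule bdd_kernel_graphon) fact
  have kc: "bdd_kernel c"
    unfolding c_def by (intro bdd_kernel_diff pos_kernel_ln g bdd_kernel_const)
  have kW1: "bdd_kernel W1" unfolding W1_def by (intro bdd_kernel_mult kW kc)
  have kW2: "bdd_kernel W2" unfolding W2_def by (intro bdd_kernel_mult bdd_kernel_power2 kW kc)
  have I: "square_integral W1 = 0" "square_integral W2 = A"
    using m1 m2 by (simp_all add: W1_def[abs_def] W2_def[abs_def] c_def)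
  have ln: "ln (tensor_square g s t) - 2 * K = c (\<phi> s) (\<phi> t) + c (\<psi> s) (\<psi> t)"
    if "s \<in> {0..1}" "t \<in> {0..1}" for s t
    using pos_kernel_pos[OF g split_in_unit(1)[OF that(1)] split_in_unit(1)[OF that(2)]]
      pos_kernel_pos[OF g split_in_unit(2)[OF that(1)] split_in_unit(2)[OF that(2)]]
    by (simp add: tensor_square_def c_def ln_mult)
  note T = square_integral_tensor bdd_kernel_tensor
  have "square_integral (\<lambda>s t. tensor_square W s t * (ln (tensor_square g s t) - 2 * K)) =
    square_integral (\<lambda>s t. W1 (\<phi> s) (\<phi> t) * W (\<psi> s) (\<psi> t) + W (\<phi> s) (\<phi> t) * W1 (\<psi> s) (\<psi> t))"
    by (rule square_integral_cong) (simp only: ln, simp add: tensor_square_def W1_def algebra_simps)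
  also have "\<dots> = 0"
    by (subst square_integral_add[OF T(2)[OF kW1 kW] T(2)[OF kW kW1]])
       (simp only: T(1)[OF kW1 kW] T(1)[OF kW kW1] I mult_zero_left mult_zero_right add_0)
  finally have M1: "square_integral (\<lambda>s t. tensor_square W s t * (ln (tensor_square g s t) - 2 * K)) = 0" .
  \<comment> \<open>Expanding the square leaves two second moments and a cross term, which vanishes
    because \<open>W1\<close> has integral 0.\<close>
  have "square_integral (\<lambda>s t. tensor_square W s t * (ln (tensor_square g s t) - 2 * K)\<^sup>2) =
    square_integral (\<lambda>s t. (W2 (\<phi> s) (\<phi> t) * W (\<psi> s) (\<psi> t) + W (\<phi> s) (\<phi> t) * W2 (\<psi> s) (\<psi> t))
       + 2 * (W1 (\<phi> s) (\<phi> t) * W1 (\<psi> s) (\<psi> t)))"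
    by (rule square_integral_cong)
       (simp only: ln, simp add: tensor_square_def W1_def W2_def power2_eq_square algebra_simps)
  also have "\<dots> = square_integral (\<lambda>s t. W2 (\<phi> s) (\<phi> t) * W (\<psi> s) (\<psi> t) + W (\<phi> s) (\<phi> t) * W2 (\<psi> s) (\<psi> t))
      + square_integral (\<lambda>s t. 2 * (W1 (\<phi> s) (\<phi> t) * W1 (\<psi> s) (\<psi> t)))"
    by (rule square_integral_add[OF bdd_kernel_add[OF T(2)[OF kW2 kW] T(2)[OF kW kW2]]
          bdd_kernel_mult[OF bdd_kernel_const T(2)[OF kW1 kW1]]])
  also have "\<dots> = 2 * p * A"
    by (subst square_integral_add[OF T(2)[OF kW2 kW] T(2)[OF kW kW2]])
       (simp only: T(1)[OF kW2 kW] T(1)[OF kW kW2] T(1)[OF kW1 kW1] square_integral_cmult I p, simp)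
  finally have M2: "square_integral (\<lambda>s t. tensor_square W s t * (ln (tensor_square g s t) - 2 * K)\<^sup>2) =
    2 * p * A" .
  have "pos_kernel (tensor_square g)"
    unfolding tensor_square_def
    by (rule pos_kernel_mult[OF pos_kernel_pullback[OF g measurable_split(1)]
          pos_kernel_pullback[OF g measurable_split(2)]])
  moreover have "square_integral (tensor_square W) = p\<^sup>2"
    unfolding tensor_square_def using square_integral_tensor[OF kW kW] p by (simp add: power2_eq_square)
  moreover have "tensor_square (\<lambda>s t. 1 / g s t) = (\<lambda>s t. 1 / tensor_square g s t)"
    by (intro ext) (simp add: tensor_square_def)
  hence "weighted_density V E u v (tensor_square W) (\<lambda>s t. 1 / tensor_square g s t) = \<theta>\<^sup>2"
    using weighted_density_tensor_square[OF W assms(1-4) pos_kernel_inverse[OF g]] \<theta> by simp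
  ultimately show ?thesis
    using M1 M2 graphon_tensor_square[OF W] by (simp add: concentrated_def)
qed

text \<open>\<open>B\<close> is the variance under \<open>W / p\<close>. After \<open>m\<close>
  squarings there are \<open>n = 2 ^ m\<close> factors, with mean \<open>n * K\<close> and variance
  \<open>n * B\<close>.\<close>

lemma concentrated_tensor_power:
  assumes "finite V" "edges_on V E" "u \<in> V" "v \<in> V" and "concentrated V E u v W g p K (p * B) \<theta>"
  shows "concentrated V E u v ((tensor_square ^^ m) W) ((tensor_square ^^ m) g)
    (p ^ 2 ^ m) (2 ^ m * K) (2 ^ m * p ^ 2 ^ m * B) (\<theta> ^ 2 ^ m)"
proof (induction m)
  case 0
  thus ?case using assms by simp
next
  case (Suc m)
  have pow: "x ^ 2 ^ Suc m = (x ^ 2 ^ m)\<^sup>2" for x :: real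
    by (simp only: power_mult[symmetric] power_Suc2)
  have "2 * p ^ 2 ^ m * (2 ^ m * p ^ 2 ^ m * B) = 2 ^ Suc m * p ^ 2 ^ Suc m * B"
    unfolding pow by (simp add: power2_eq_square)
  moreover have "2 * (2 ^ m * K) = 2 ^ Suc m * K"
    by simp
  ultimately show ?case
    using concentrated_tensor_square[OF assms(1-4) Suc] by (simp only: pow funpow.simps comp_apply)
qed

end

text \<open>Sidorenko's inequality is applied to \<open>W\<close> restricted to the pairs where \<open>ln g\<close> does not
  exceed its mean by more than \<open>r\<close> in either orientation. Both orientations are needed because \<open>g\<close>
  need not be symmetric while a graphon must be; on the pairs that are kept, \<open>1 \<le> exp (K + r) / g\<close>.\<close>

lemma sidorenko_chebyshev:
  assumes sid: "\<And>W. graphon W \<Longrightarrow>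
      square_integral W ^ card E \<le> (LINT x|cube V. (\<Prod>e\<in>E. edge_weight W x e))"
    and "finite V" "edges_on V E" "{u, v} \<in> E" and conc: "concentrated V E u v W g p K A \<theta>"
    and r: "0 < r" "2 * A / r\<^sup>2 \<le> p"
  shows "(p - 2 * A / r\<^sup>2) ^ card E \<le> exp (K + r) * \<theta>"
proof -
  have W: "graphon W" and g: "pos_kernel g" and p: "square_integral W = p"
    and m2: "square_integral (\<lambda>s t. W s t * (ln (g s t) - K)\<^sup>2) = A"
    and \<theta>: "weighted_density V E u v W (\<lambda>s t. 1 / g s t) = \<theta>"
    using conc by (auto simp: concentrated_def)
  have uv: "u \<in> V" "v \<in> V"
    using assms(3,4) by (auto simp: edges_on_def doubleton_eq_iff)
  have fin: "finite E"
    using assms by (simp add: finite_edges_on)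
  define W2 where "W2 s t = W s t * (ln (g s t) - K)\<^sup>2" for s t
  define X where "X s t = (if ln (g s t) \<le> K + r \<and> ln (g t s) \<le> K + r then W s t else 0)" for s t
  have kW: "bdd_kernel W" by (rule bdd_kernel_graphon) fact
  have kl: "bdd_kernel (\<lambda>s t. ln (g s t))" by (rule pos_kernel_ln[OF g])
  have kW2: "bdd_kernel W2"
    unfolding W2_def by (intro bdd_kernel_mult bdd_kernel_power2 bdd_kernel_diff bdd_kernel_const kW kl)
  note [measurable] = bdd_kernel_measurable[OF kW] bdd_kernel_measurable[OF kl]
    bdd_kernel_measurable[OF bdd_kernel_swap[OF kl]]
  have [measurable]: "case_prod X \<in> borel_measurable unit_square"
    unfolding X_def by measurable
  have X: "graphon X"
    using graphonD[OF W] unfolding graphon_def by (auto simp: X_def)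
  have kX: "bdd_kernel X" by (rule bdd_kernel_graphon) fact
  have kd: "bdd_kernel (\<lambda>s t. 1 / r\<^sup>2 * (W2 s t + W2 t s))"
    by (intro bdd_kernel_mult bdd_kernel_const bdd_kernel_add kW2 bdd_kernel_swap[OF kW2])
  \<comment> \<open>Chebyshev's argument: on a discarded pair one of the two orientations deviates
    by more than \<open>r\<close>, so \<open>W\<close> is at most the corresponding second moment
    term over \<open>r\<^sup>2\<close>. Both terms have integral \<open>A\<close>, whence the
    constant 2.\<close>
  have "square_integral (\<lambda>s t. W s t - 1 / r\<^sup>2 * (W2 s t + W2 t s)) \<le> square_integral X"
  proof (intro square_integral_mono bdd_kernel_diff kW kX kd)
    fix s t :: real assume st: "s \<in> {0..1}" "t \<in> {0..1}"
    have W0: "0 \<le> W s t" "W t s = W s t"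
      using graphonD[OF W st] by simp_all
    have W20: "0 \<le> W2 s t" "0 \<le> W2 t s"
      using W0 by (simp_all add: W2_def)
    have big: "W s t \<le> 1 / r\<^sup>2 * (W s t * (x - K)\<^sup>2)" if "\<not> x \<le> K + r" for x
    proof -
      have "r\<^sup>2 \<le> (x - K)\<^sup>2" using that r by (intro power_mono) auto
      hence "W s t * r\<^sup>2 \<le> W s t * (x - K)\<^sup>2" using W0 by (intro mult_left_mono) auto
      thus ?thesis using r by (simp add: field_simps)
    qed
    show "W s t - 1 / r\<^sup>2 * (W2 s t + W2 t s) \<le> X s t"
    proof (cases "ln (g s t) \<le> K + r \<and> ln (g t s) \<le> K + r")
      case True
      thus ?thesis using W20 by (simp add: X_def)
    next
      case False
      hence "W s t \<le> 1 / r\<^sup>2 * W2 s t \<or> W s t \<le> 1 / r\<^sup>2 * W2 t s"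
        using big[of "ln (g s t)"] big[of "ln (g t s)"] W0(2) by (auto simp: W2_def)
      moreover have "0 \<le> 1 / r\<^sup>2 * W2 s t" "0 \<le> 1 / r\<^sup>2 * W2 t s"
        using W20 by simp_all
      ultimately show ?thesis
        using False by (simp add: X_def distrib_left) linarith
    qed
  qed
  also have "square_integral (\<lambda>s t. W s t - 1 / r\<^sup>2 * (W2 s t + W2 t s)) =
      p - 1 / r\<^sup>2 * (A + A)"
    using m2 by (simp only: square_integral_diff[OF kW kd] square_integral_cmult p
        square_integral_add[OF kW2 bdd_kernel_swap[OF kW2]] square_integral_swap[OF kW2])
      (simp add: W2_def[abs_def])
  finally have "(p - 2 * A / r\<^sup>2) ^ card E \<le> square_integral X ^ card E"
    using r by (intro power_mono) (auto simp: algebra_simps)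
  also have "\<dots> \<le> (LINT x|cube V. (\<Prod>e\<in>E. edge_weight X x e))"
    by (rule sid[OF X])
  \<comment> \<open>If \<open>X\<close> vanishes at the positions of \<open>u\<close> and
    \<open>v\<close>, the factor of the edge between them kills the product. Otherwise
    \<open>X \<le> W\<close> on every edge and \<open>1 \<le> exp (K + r) / g\<close> at that
    pair.\<close>
  also have "\<dots> \<le> (LINT x|cube V. exp (K + r) * ((\<Prod>e\<in>E. edge_weight W x e) * (1 / g (x u) (x v))))"
  proof (rule integral_mono)
    show "integrable (cube V) (\<lambda>x. \<Prod>e\<in>E. edge_weight X x e)"
      using integrable_weighted_density[OF X assms(3) uv bdd_kernel_const[of 1]] by simp
    show "integrable (cube V) (\<lambda>x. exp (K + r) * ((\<Prod>e\<in>E. edge_weight W x e) * (1 / g (x u) (x v))))"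
      by (intro integrable_mult_right integrable_weighted_density[OF W assms(3) uv pos_kernel_inverse[OF g]])
    fix x assume "x \<in> space (cube V)"
    hence x: "x \<in> V \<rightarrow> {0..1}" by (rule space_cube)
    hence xuv: "x u \<in> {0..1}" "x v \<in> {0..1}" using uv by auto
    let ?P = "\<Prod>e\<in>E. edge_weight W x e"
    have P0: "0 \<le> ?P" by (rule prod_edge_weight_bounds[OF W assms(3) x])
    have g0: "0 < g (x u) (x v)" by (rule pos_kernel_pos[OF g xuv])
    show "(\<Prod>e\<in>E. edge_weight X x e) \<le> exp (K + r) * (?P * (1 / g (x u) (x v)))"
    proof (cases "X (x u) (x v) = 0")
      case True
      hence "edge_weight X x {u, v} = 0"
        by (simp add: edge_weight_graphon[where x = x, OF X xuv])
      hence "(\<Prod>e\<in>E. edge_weight X x e) = 0"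
        by (intro prod_zero fin bexI[OF _ assms(4)])
      thus ?thesis using P0 g0 by simp
    next
      case False
      hence "ln (g (x u) (x v)) \<le> K + r" by (auto simp: X_def split: if_splits)
      hence "g (x u) (x v) \<le> exp (K + r)"
        using g0 by (metis exp_le_cancel_iff exp_ln)
      hence 1: "1 \<le> exp (K + r) / g (x u) (x v)"
        using g0 by (simp add: field_simps)
      have "(\<Prod>e\<in>E. edge_weight X x e) \<le> ?P"
      proof (rule prod_mono, rule conjI)
        fix e assume e: "e \<in> E"
        show "0 \<le> edge_weight X x e"
          by (rule edge_weight_bounds[OF X assms(3) e x])
        obtain a b where ab: "a \<in> V" "b \<in> V" "e = {a, b}"
          using edges_onE[OF assms(3) e] by blast
        hence xab: "x a \<in> {0..1}" "x b \<in> {0..1}" using x by auto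
        show "edge_weight X x e \<le> edge_weight W x e"
          using graphonD[OF W xab] ab
          by (simp add: edge_weight_graphon[where x = x, OF X xab] edge_weight_graphon[where x = x, OF W xab]) (simp add: X_def)
      qed
      also have "\<dots> \<le> ?P * (exp (K + r) / g (x u) (x v))"
        using mult_left_mono[OF 1 P0] by simp
      finally show ?thesis by (simp add: field_simps)
    qed
  qed
  also have "\<dots> = exp (K + r) * \<theta>"
    using \<theta> unfolding weighted_density_def by (simp only: integral_mult_right_zero)
  finally show ?thesis .
qed

text \<open>The Chebyshev bound is applied to the tensor power with \<open>n = 2 ^ m\<close> factors
  and \<open>r = n * \<epsilon>\<close>. After taking logarithms and dividing by \<open>n\<close>,
  the loss of a factor 2 in mass disappears as \<open>m\<close> grows.\<close>

lemma sidorenko_ln_link_density: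
  assumes sid: "\<And>W. graphon W \<Longrightarrow>
      square_integral W ^ card E \<le> (LINT x|cube V. (\<Prod>e\<in>E. edge_weight W x e))"
    and "finite V" "edges_on V E" "{u, v} \<in> E" "u \<noteq> v"
    and W: "graphon W" and p: "square_integral W = p" "0 < p" and \<delta>: "0 < \<delta>"
  shows "p * ((real (card E) - 1) * ln p) \<le>
    square_integral (\<lambda>s t. W s t * ln (link_density V E u v W s t + \<delta>))"
proof -
  obtain \<phi> \<psi> where "indep_copies unit_measure \<phi> \<psi>"
    using unit_square_parametrization unfolding indep_copies_def by metis
  then interpret unit_split \<phi> \<psi> by unfold_locales
  have uv: "u \<in> V" "v \<in> V"
    using assms(3,4) by (auto simp: edges_on_def doubleton_eq_iff)
  define a where "a = real (card E)"
  define g where "g s t = link_density V E u v W s t + \<delta>" for s t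
  have kW: "bdd_kernel W" by (rule bdd_kernel_graphon) fact
  note lb = link_density_bounds[OF W assms(3) uv assms(5)]
  have kL: "bdd_kernel (link_density V E u v W)"
    using lb by (intro bdd_kernelI[of _ 1] measurable_link_density W assms uv) auto
  have g: "pos_kernel g"
    unfolding g_def using lb \<delta> by (intro pos_kernelI[of _ \<delta>] bdd_kernel_add kL bdd_kernel_const) auto
  have kl: "bdd_kernel (\<lambda>s t. ln (g s t))" by (rule pos_kernel_ln[OF g])
  define K where "K = square_integral (\<lambda>s t. W s t * ln (g s t)) / p"
  define B where "B = square_integral (\<lambda>s t. W s t * (ln (g s t) - K)\<^sup>2) / p"
  define \<theta> where "\<theta> = weighted_density V E u v W (\<lambda>s t. 1 / g s t)"
  have "square_integral (\<lambda>s t. W s t * (ln (g s t) - K)) =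
      square_integral (\<lambda>s t. W s t * ln (g s t) - K * W s t)"
    by (simp add: algebra_simps)
  also have "\<dots> = 0"
    using p by (simp only: square_integral_diff[OF bdd_kernel_mult[OF kW kl] bdd_kernel_mult[OF bdd_kernel_const kW]]
        square_integral_cmult) (simp add: K_def)
  finally have conc: "concentrated V E u v W g p K (p * B) \<theta>"
    using p W g by (simp add: concentrated_def B_def \<theta>_def)
  \<comment> \<open>\<open>\<theta>\<close> is the integral of \<open>W * f / (f + \<delta>)\<close>
    for the link density \<open>f\<close>, hence at most the integral of \<open>W\<close>. The
    resulting factor \<open>p ^ n\<close> on the right accounts for the exponent
    \<open>card E - 1\<close>.\<close>
  have \<theta>: "0 \<le> \<theta>" "\<theta> \<le> p"
  proof -
    have \<theta>_eq: "\<theta> = square_integral (\<lambda>s t. W s t * link_density V E u v W s t * (1 / g s t))"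
      unfolding \<theta>_def by (rule weighted_density_eq[OF W assms(2-5) pos_kernel_inverse[OF g]])
    also have "\<dots> \<le> square_integral W"
    proof (intro square_integral_mono bdd_kernel_mult kW kL pos_kernel_inverse g)
      fix s t :: real assume st: "s \<in> {0..1}" "t \<in> {0..1}"
      have "link_density V E u v W s t * (1 / g s t) \<le> 1"
        using lb(1)[OF st] \<delta> by (simp add: g_def)
      from mult_left_mono[OF this graphonD(2)[OF W st]]
      show "W s t * link_density V E u v W s t * (1 / g s t) \<le> W s t" by simp
    qed
    finally show "\<theta> \<le> p" by (simp add: p)
    show "0 \<le> \<theta>"
      unfolding \<theta>_eq using lb(1) graphonD(2)[OF W] pos_kernel_pos[OF g]
      by (intro integral_nonneg_AE AE_I2) (auto intro!: mult_nonneg_nonneg divide_nonneg_pos)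
  qed
  have "(a - 1) * ln p \<le> K + \<epsilon>" if "\<epsilon> > 0" for \<epsilon>
  proof (rule tendsto_upperbound)
    show "(\<lambda>m. (a - 1) * ln p - a * ln 2 / 2 ^ m) \<longlonglongrightarrow> (a - 1) * ln p"
      by real_asymp
    have "(\<lambda>m. 2 * B / (2 ^ m * \<epsilon>\<^sup>2)) \<longlonglongrightarrow> 0"
      using that by real_asymp
    hence "\<forall>\<^sub>F m in sequentially. 2 * B / (2 ^ m * \<epsilon>\<^sup>2) < 1/2"
      by (rule order_tendstoD) simp
    thus "\<forall>\<^sub>F m in sequentially. (a - 1) * ln p - a * ln 2 / 2 ^ m \<le> K + \<epsilon>"
    proof eventually_elim
      fix m assume m: "2 * B / (2 ^ m * \<epsilon>\<^sup>2) < 1/2"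
      define n :: nat where "n = 2 ^ m"
      have n: "0 < real n" "(2::real) ^ m = real n" by (simp_all add: n_def)
      \<comment> \<open>The variance \<open>n * B\<close> is set against the squared deviation
        \<open>(n * \<epsilon>)\<^sup>2\<close>, so the discarded fraction of the mass
        \<open>p ^ n\<close> is at most of order \<open>1 / n\<close>, and below one half by the
        choice of \<open>m\<close>.\<close>
      have q: "2 * (real n * p ^ n * B) / (real n * \<epsilon>)\<^sup>2 = p ^ n * (2 * B / (2 ^ m * \<epsilon>\<^sup>2))"
        using n that by (simp add: power2_eq_square field_simps)
      also have "\<dots> \<le> p ^ n * (1/2)"
        using m p by (intro mult_left_mono) auto
      finally have le: "2 * (real n * p ^ n * B) / (real n * \<epsilon>)\<^sup>2 \<le> p ^ n / 2" by simp
      have "(p ^ n / 2) ^ card E \<le> (p ^ n - 2 * (real n * p ^ n * B) / (real n * \<epsilon>)\<^sup>2) ^ card E"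
        using le p by (intro power_mono) auto
      also have "\<dots> \<le> exp (real n * K + real n * \<epsilon>) * \<theta> ^ n"
      proof (rule sidorenko_chebyshev[OF sid assms(2-4)])
        show "concentrated V E u v ((tensor_square ^^ m) W) ((tensor_square ^^ m) g)
          (p ^ n) (real n * K) (real n * p ^ n * B) (\<theta> ^ n)"
          using concentrated_tensor_power[OF assms(2,3) uv conc, of m] by (simp add: n_def)
        show "2 * (real n * p ^ n * B) / (real n * \<epsilon>)\<^sup>2 \<le> p ^ n"
          using order.trans[OF le] p(2) by simp
        show "0 < real n * \<epsilon>" using n that by simp
      qed
      finally have main: "(p ^ n / 2) ^ card E \<le> exp (real n * (K + \<epsilon>)) * \<theta> ^ n"
        by (simp add: algebra_simps)
      have "\<theta> ^ n \<le> p ^ n"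
        using \<theta> by (intro power_mono)
      hence "(p ^ n / 2) ^ card E \<le> exp (real n * (K + \<epsilon>)) * p ^ n"
        using main by (smt (verit) exp_ge_zero mult_left_mono)
      \<comment> \<open>In logarithms the lost factor 2 costs the constant \<open>a * ln 2\<close>,
        which becomes \<open>a * ln 2 / n\<close> after division by \<open>n\<close>.\<close>
      hence "ln ((p ^ n / 2) ^ card E) \<le> ln (exp (real n * (K + \<epsilon>)) * p ^ n)"
        using p by (subst ln_le_cancel_iff) auto
      hence "a * (real n * ln p - ln 2) \<le> real n * (K + \<epsilon>) + real n * ln p"
        using p by (simp add: ln_realpow ln_div ln_mult a_def)
      hence "real n * ((a - 1) * ln p - a * ln 2 / real n) \<le> real n * (K + \<epsilon>)"
        using n(1) by (simp add: algebra_simps)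
      thus "(a - 1) * ln p - a * ln 2 / 2 ^ m \<le> K + \<epsilon>"
        unfolding n(2) using n(1) by simp
    qed
  qed simp
  hence "(a - 1) * ln p \<le> K"
    by (rule field_le_epsilon)
  hence "p * ((a - 1) * ln p) \<le> p * K"
    using p by (intro mult_left_mono) auto
  thus ?thesis
    using p by (simp add: K_def a_def g_def)
qed

section \<open>Gluing along an edge\<close>

lemma finite_simple_graph_edges_on: "finite_simple_graph H \<Longrightarrow> edges_on (verts H) (edges H)"
  unfolding finite_simple_graph_def edges_on_def by blast

text \<open>A change of variables: reindexing along an injection preserves the product measure, and
  distinct edges keep distinct images, so the product over edges reindexes as well.\<close>

lemma hom_density_map_graph:
  fixes f :: "'a \<Rightarrow> 'b"
  assumes "graphon W" "inj_on f (verts H)" "edges_on (verts H) (edges H)"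
  shows "hom_density (map_graph f H) W = hom_density H W"
proof -
  let ?V = "verts H" and ?E = "edges H"
  let ?t = "\<lambda>x. \<lambda>i\<in>?V. x (f i) :: real"
  have sub: "?E \<subseteq> Pow ?V"
    using assms(3) by (rule edges_on_subset)
  have inj: "inj_on ((`) f) ?E"
    by (rule inj_on_subset[OF inj_on_image_Pow[OF assms(2)] sub])
  have D: "distr (cube (f ` ?V)) (cube ?V) ?t = cube ?V"
    by (rule distr_PiM_reindex[where M = "\<lambda>_. unit_measure"])
       (use assms(2) unit_measure.prob_space_axioms in auto)
  have t: "?t \<in> measurable (cube (f ` ?V)) (cube ?V)"
    by (rule measurable_restrict) simp
  have "hom_density H W = (LINT x|distr (cube (f ` ?V)) (cube ?V) ?t. (\<Prod>e\<in>?E. edge_weight W x e))"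
    by (simp add: hom_density_def D)
  also have "\<dots> = (LINT x|cube (f ` ?V). (\<Prod>e\<in>?E. edge_weight W (?t x) e))"
    by (rule integral_distr[OF t measurable_prod_edge_weight[OF assms(1,3)]])
  also have "\<dots> = (LINT x|cube (f ` ?V). (\<Prod>e\<in>?E. edge_weight W x (f ` e)))"
  proof (intro Bochner_Integration.integral_cong refl prod.cong)
    fix x e assume x: "x \<in> space (cube (f ` ?V))" and e: "e \<in> ?E"
    obtain a b where ab: "a \<in> ?V" "b \<in> ?V" "e = {a, b}"
      using edges_onE[OF assms(3) e] by blast
    hence "x (f a) \<in> {0..1}" "x (f b) \<in> {0..1}"
      using space_cube[OF x] by auto
    thus "edge_weight W (?t x) e = edge_weight W x (f ` e)"
      using ab by (simp add: edge_weight_graphon[OF assms(1)])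
  qed
  also have "\<dots> = hom_density (map_graph f H) W"
    by (simp add: hom_density_def map_graph_def prod.reindex[OF inj])
  finally show ?thesis ..
qed

lemma sidorenko_map_graph:
  assumes "sidorenko H" "inj_on f (verts H)"
  shows "sidorenko (map_graph f H)"
proof -
  have H: "finite_simple_graph H" "bipartite H"
    using assms by (auto simp: sidorenko_def)
  note E = finite_simple_graph_edges_on[OF H(1)]
  have "edges H \<subseteq> Pow (verts H)"
    using E by (rule edges_on_subset)
  from inj_on_subset[OF inj_on_image_Pow[OF assms(2)] this]
  have card: "card (edges (map_graph f H)) = card (edges H)"
    by (simp add: map_graph_def card_image)
  have "finite_simple_graph (map_graph f H)"
    unfolding finite_simple_graph_def
  proof (intro conjI ballI)
    show "finite (verts (map_graph f H))"
      using H by (simp add: map_graph_def finite_simple_graph_def)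
    fix e assume "e \<in> edges (map_graph f H)"
    then obtain u v where uv: "u \<in> verts H" "v \<in> verts H" "u \<noteq> v" "e = f ` {u, v}"
      using H(1) unfolding map_graph_def finite_simple_graph_def by force
    thus "\<exists>u\<in>verts (map_graph f H). \<exists>v\<in>verts (map_graph f H). u \<noteq> v \<and> e = {u, v}"
      using inj_onD[OF assms(2), of u v]
      by (intro bexI[of _ "f u"] bexI[of _ "f v"]) (auto simp: map_graph_def)
  qed
  moreover have "bipartite (map_graph f H)"
  proof -
    obtain A B where AB: "A \<union> B = verts H" "A \<inter> B = {}" "\<forall>e\<in>edges H. \<exists>u\<in>A. \<exists>v\<in>B. e = {u, v}"
      using H(2) unfolding bipartite_def by blast
    have "f ` A \<inter> f ` B = {}"
      using AB(1,2) assms(2) inj_on_image_Int[of f "verts H" A B] by auto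
    moreover have "\<forall>e\<in>edges (map_graph f H). \<exists>u\<in>f ` A. \<exists>v\<in>f ` B. e = {u, v}"
      using AB(3) by (fastforce simp: map_graph_def)
    moreover have "f ` A \<union> f ` B = verts (map_graph f H)"
      using AB(1) by (auto simp: map_graph_def)
    ultimately show ?thesis
      unfolding bipartite_def by blast
  qed
  ultimately show ?thesis
    using assms by (simp add: sidorenko_def card hom_density_map_graph E)
qed

section \<open>Bipartiteness of a union along an edge\<close>

text \<open>Exchanging the classes if necessary makes the bipartitions of two graphs agree on a
  common edge, so that they can be united class by class.\<close>

lemma bipartite_oriented:
  assumes "bipartite H" "{u, v} \<in> edges H"
  obtains A B where "A \<union> B = verts H" "A \<inter> B = {}" "u \<in> A" "v \<in> B"
    "\<forall>e\<in>edges H. \<exists>a\<in>A. \<exists>b\<in>B. e = {a, b}"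
proof -
  obtain A B where AB: "A \<union> B = verts H" "A \<inter> B = {}" "\<forall>e\<in>edges H. \<exists>a\<in>A. \<exists>b\<in>B. e = {a, b}"
    using assms unfolding bipartite_def by blast
  then obtain a b where "a \<in> A" "b \<in> B" "{u, v} = {a, b}"
    using assms by blast
  hence "u \<in> A \<and> v \<in> B \<or> u \<in> B \<and> v \<in> A"
    by (auto simp: doubleton_eq_iff)
  thus ?thesis
  proof
    assume "u \<in> A \<and> v \<in> B"
    thus ?thesis using AB by (intro that[of A B]) auto
  next
    assume "u \<in> B \<and> v \<in> A"
    moreover have "\<forall>e\<in>edges H. \<exists>a\<in>B. \<exists>b\<in>A. e = {a, b}"
      using AB(3) by (metis insert_commute)
    ultimately show ?thesis using AB(1,2) by (intro that[of B A]) auto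
  qed
qed

text \<open>A vertex in both united classes would belong to both graphs, hence be \<open>u\<close>
  or \<open>v\<close>, and these two are placed consistently by the two bipartitions.\<close>

lemma bipartite_union_edge:
  assumes "bipartite G1" "bipartite G2"
    and V: "verts G1 \<inter> verts G2 = {u, v}" and E: "{u, v} \<in> edges G1" "{u, v} \<in> edges G2"
  shows "bipartite \<lparr>verts = verts G1 \<union> verts G2, edges = edges G1 \<union> edges G2\<rparr>"
proof -
  obtain A1 B1 where 1: "A1 \<union> B1 = verts G1" "A1 \<inter> B1 = {}" "u \<in> A1" "v \<in> B1"
    "\<forall>e\<in>edges G1. \<exists>a\<in>A1. \<exists>b\<in>B1. e = {a, b}"
    using bipartite_oriented[OF assms(1) E(1)] by blast
  obtain A2 B2 where 2: "A2 \<union> B2 = verts G2" "A2 \<inter> B2 = {}" "u \<in> A2" "v \<in> B2"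
    "\<forall>e\<in>edges G2. \<exists>a\<in>A2. \<exists>b\<in>B2. e = {a, b}"
    using bipartite_oriented[OF assms(2) E(2)] by blast
  have disj: "(A1 \<union> A2) \<inter> (B1 \<union> B2) = {}"
  proof (rule equals0I)
    fix w assume w: "w \<in> (A1 \<union> A2) \<inter> (B1 \<union> B2)"
    hence "w \<in> verts G1 \<inter> verts G2"
      using 1(1,2) 2(1,2) by blast
    hence "w = u \<or> w = v"
      unfolding V by blast
    thus False
      using w 1(2-4) 2(2-4) by blast
  qed
  show ?thesis
    unfolding bipartite_def
  proof (intro exI conjI)
    show "(A1 \<union> A2) \<union> (B1 \<union> B2) = verts \<lparr>verts = verts G1 \<union> verts G2, edges = edges G1 \<union> edges G2\<rparr>"
      using 1(1) 2(1) by auto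
    show "\<forall>e\<in>edges \<lparr>verts = verts G1 \<union> verts G2, edges = edges G1 \<union> edges G2\<rparr>.
        \<exists>a\<in>A1 \<union> A2. \<exists>b\<in>B1 \<union> B2. e = {a, b}"
    proof
      fix e assume "e \<in> edges \<lparr>verts = verts G1 \<union> verts G2, edges = edges G1 \<union> edges G2\<rparr>"
      hence "e \<in> edges G1 \<or> e \<in> edges G2" by simp
      thus "\<exists>a\<in>A1 \<union> A2. \<exists>b\<in>B1 \<union> B2. e = {a, b}"
        using 1(5) 2(5) by (meson UnI1 UnI2)
    qed
  qed (rule disj)
qed

section \<open>The density inequality for a union along an edge\<close>

text \<open>Jensen's inequality is used in its tangent form \<open>ln x \<le> x - 1\<close> at
  \<open>x = g1 * g2 / c\<close>, multiplied by \<open>W\<close> and integrated, where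
  \<open>c = p ^ (a + b)\<close> is chosen to cancel the two logarithmic lower bounds.\<close>

lemma hom_density_union_edge:
  assumes "sidorenko G1" "sidorenko G2" "u \<noteq> v"
    and V: "verts G1 \<inter> verts G2 = {u, v}" and E: "edges G1 \<inter> edges G2 = {{u, v}}"
    and W: "graphon W"
  shows "square_integral W ^ card (edges G1 \<union> edges G2) \<le>
    hom_density \<lparr>verts = verts G1 \<union> verts G2, edges = edges G1 \<union> edges G2\<rparr> W"
proof -
  have fin: "finite (verts G1)" "finite (verts G2)"
    and E1: "edges_on (verts G1) (edges G1)" and E2: "edges_on (verts G2) (edges G2)"
    using assms(1,2) finite_simple_graph_edges_on
    by (auto simp: sidorenko_def finite_simple_graph_def)
  have sid1: "square_integral W ^ card (edges G1) \<le> (LINT x|cube (verts G1). (\<Prod>e\<in>edges G1. edge_weight W x e))"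
    and sid2: "square_integral W ^ card (edges G2) \<le> (LINT x|cube (verts G2). (\<Prod>e\<in>edges G2. edge_weight W x e))"
    if "graphon W" for W
    using assms(1,2) that by (auto simp: sidorenko_def hom_density_def)
  have "{u, v} \<in> edges G1 \<inter> edges G2" "u \<in> verts G1 \<inter> verts G2" "v \<in> verts G1 \<inter> verts G2"
    by (simp_all add: E V)
  hence e: "{u, v} \<in> edges G1" "{u, v} \<in> edges G2"
    and uv: "u \<in> verts G1" "v \<in> verts G1" "u \<in> verts G2" "v \<in> verts G2"
    by simp_all
  have finE: "finite (edges G1)" "finite (edges G2)"
    using fin E1 E2 by (simp_all add: finite_edges_on)
  define p where "p = square_integral W"
  define f1 where "f1 = link_density (verts G1) (edges G1) u v W"
  define f2 where "f2 = link_density (verts G2) (edges G2) u v W"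
  \<comment> \<open>These count the edges other than the shared one, so the union has
    \<open>a + b + 1\<close> edges.\<close>
  define a b where "a = card (edges G1) - 1" and "b = card (edges G2) - 1"
  have ca: "card (edges G1) = Suc a" and cb: "card (edges G2) = Suc b"
    unfolding a_def b_def using finE e by (metis Suc_diff_1 card_gt_0_iff empty_iff)+
  have card: "card (edges G1 \<union> edges G2) = Suc (a + b)"
    using card_Un_Int[OF finE] by (simp add: E ca cb)
  note b1 = link_density_bounds[OF W E1 uv(1,2) assms(3), folded f1_def]
  note b2 = link_density_bounds[OF W E2 uv(3,4) assms(3), folded f2_def]
  have kW: "bdd_kernel W" by (rule bdd_kernel_graphon) fact
  have k1: "bdd_kernel f1"
    using b1 measurable_link_density[OF W E1 uv(1,2) assms(3), folded f1_def]
    by (intro bdd_kernelI[of _ 1]) auto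
  have k2: "bdd_kernel f2"
    using b2 measurable_link_density[OF W E2 uv(3,4) assms(3), folded f2_def]
    by (intro bdd_kernelI[of _ 1]) auto
  have dens: "hom_density \<lparr>verts = verts G1 \<union> verts G2, edges = edges G1 \<union> edges G2\<rparr> W =
      square_integral (\<lambda>s t. W s t * f1 s t * f2 s t)"
    using glued_density_eq_integral_link[OF W fin E1 E2 assms(3) V E]
    by (simp add: hom_density_def f1_def f2_def)
  have p0: "0 \<le> p"
    unfolding p_def using graphonD[OF W] by (intro integral_nonneg_AE AE_I2) auto
  have "p ^ Suc (a + b) \<le> square_integral (\<lambda>s t. W s t * f1 s t * f2 s t)"
  proof (cases "p = 0")
    case True
    have "0 \<le> square_integral (\<lambda>s t. W s t * f1 s t * f2 s t)"
      using graphonD[OF W] b1 b2 by (intro integral_nonneg_AE AE_I2) auto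
    thus ?thesis using True by simp
  next
    case False
    hence p: "0 < p" using p0 by simp
    show ?thesis
    proof (rule field_le_epsilon)
      fix \<epsilon> :: real assume \<epsilon>: "0 < \<epsilon>"
      \<comment> \<open>Replacing both link densities by their values plus \<open>\<delta>\<close>
        raises the integrand by at most \<open>(f1 + f2 + \<delta>) * \<delta>\<close>, which is at
        most \<open>3 * \<delta>\<close> because \<open>f1\<close>, \<open>f2\<close> and
        \<open>\<delta>\<close> are at most 1.\<close>
      define \<delta> where "\<delta> = min 1 (\<epsilon> / 3)"
      have \<delta>: "0 < \<delta>" "\<delta> \<le> 1" "3 * \<delta> \<le> \<epsilon>" using \<epsilon> by (auto simp: \<delta>_def)
      define g1 g2 where "g1 s t = f1 s t + \<delta>" and "g2 s t = f2 s t + \<delta>" for s t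
      have kg1: "bdd_kernel g1" and kg2: "bdd_kernel g2"
        unfolding g1_def g2_def by (intro bdd_kernel_add k1 k2 bdd_kernel_const)+
      have pg1: "pos_kernel g1" and pg2: "pos_kernel g2"
        using kg1 kg2 b1 b2 \<delta> by (auto intro!: pos_kernelI[of _ \<delta>] simp: g1_def g2_def)
      have L1: "p * (real a * ln p) \<le> square_integral (\<lambda>s t. W s t * ln (g1 s t))"
        using sidorenko_ln_link_density[OF sid1 fin(1) E1 e(1) assms(3) W p_def[symmetric] p \<delta>(1)]
        by (simp add: ca f1_def g1_def)
      have L2: "p * (real b * ln p) \<le> square_integral (\<lambda>s t. W s t * ln (g2 s t))"
        using sidorenko_ln_link_density[OF sid2 fin(2) E2 e(2) assms(3) W p_def[symmetric] p \<delta>(1)]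
        by (simp add: cb f2_def g2_def)
      define c where "c = p ^ (a + b)"
      have c: "0 < c" "ln c = real a * ln p + real b * ln p"
        using p by (simp_all add: c_def ln_realpow algebra_simps)
      define l where "l s t = W s t * ln (g1 s t) + W s t * ln (g2 s t)" for s t
      have kl: "bdd_kernel l"
        unfolding l_def by (intro bdd_kernel_add bdd_kernel_mult kW pos_kernel_ln pg1 pg2)
      \<comment> \<open>By \<open>L1\<close> and \<open>L2\<close> the integral of \<open>l\<close>
        is at least \<open>p * ln c\<close>, which offsets the term
        \<open>- ln c * p\<close>.\<close>
      have "p \<le> square_integral (\<lambda>s t. (1 - ln c) * W s t + l s t)"
      proof -
        have "square_integral (\<lambda>s t. (1 - ln c) * W s t + l s t) = (1 - ln c) * p + square_integral l"
          by (simp only: square_integral_add[OF bdd_kernel_mult[OF bdd_kernel_const kW] kl]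
              square_integral_cmult p_def)
        moreover have "square_integral l =
            square_integral (\<lambda>s t. W s t * ln (g1 s t)) + square_integral (\<lambda>s t. W s t * ln (g2 s t))"
          unfolding l_def
          by (intro square_integral_add bdd_kernel_mult kW pos_kernel_ln pg1 pg2)
        ultimately show ?thesis
          using L1 L2 by (simp add: c algebra_simps)
      qed
      also have "\<dots> \<le> square_integral (\<lambda>s t. 1 / c * (W s t * g1 s t * g2 s t))"
      proof (intro square_integral_mono bdd_kernel_add bdd_kernel_mult bdd_kernel_const kW kl kg1 kg2)
        fix s t :: real assume st: "s \<in> {0..1}" "t \<in> {0..1}"
        have g: "0 < g1 s t" "0 < g2 s t"
          using pos_kernel_pos[OF pg1 st] pos_kernel_pos[OF pg2 st] by auto
        have "ln (g1 s t * g2 s t / c) \<le> g1 s t * g2 s t / c - 1"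
          using g c by (intro ln_le_minus_one) simp
        hence "1 - ln c + ln (g1 s t) + ln (g2 s t) \<le> g1 s t * g2 s t / c"
          using g c(1) by (simp add: ln_div ln_mult)
        from mult_left_mono[OF this graphonD(2)[OF W st]]
        show "(1 - ln c) * W s t + l s t \<le> 1 / c * (W s t * g1 s t * g2 s t)"
          by (simp add: l_def algebra_simps)
      qed
      also have "\<dots> = square_integral (\<lambda>s t. W s t * g1 s t * g2 s t) / c"
        by (simp only: square_integral_cmult) simp
      finally have "p ^ Suc (a + b) \<le> square_integral (\<lambda>s t. W s t * g1 s t * g2 s t)"
        using c(1) by (simp add: c_def field_simps)
      also have "\<dots> \<le> square_integral (\<lambda>s t. W s t * f1 s t * f2 s t + 3 * \<delta>)"
      proof (intro square_integral_mono bdd_kernel_add bdd_kernel_mult bdd_kernel_const kW k1 k2 kg1 kg2)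
        fix s t :: real assume st: "s \<in> {0..1}" "t \<in> {0..1}"
        have "W s t * ((f1 s t + f2 s t + \<delta>) * \<delta>) \<le> 1 * ((1 + 1 + 1) * \<delta>)"
          using graphonD[OF W st] b1[OF st] b2[OF st] \<delta> by (intro mult_mono add_mono) auto
        thus "W s t * g1 s t * g2 s t \<le> W s t * f1 s t * f2 s t + 3 * \<delta>"
          by (simp add: g1_def g2_def algebra_simps)
      qed
      also have "\<dots> = square_integral (\<lambda>s t. W s t * f1 s t * f2 s t) + 3 * \<delta>"
        by (subst square_integral_add[OF bdd_kernel_mult[OF bdd_kernel_mult[OF kW k1] k2] bdd_kernel_const])
           (use unit_square.P.prob_space in \<open>simp add: case_prod_unfold\<close>)
      finally show "p ^ Suc (a + b) \<le> square_integral (\<lambda>s t. W s t * f1 s t * f2 s t) + \<epsilon>"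
        using \<delta> by linarith
    qed
  qed
  thus ?thesis
    by (simp only: dens card p_def)
qed

lemma sidorenko_union_edge:
  assumes "sidorenko G1" "sidorenko G2"
    and V: "verts G1 \<inter> verts G2 = {u, v}" and E: "edges G1 \<inter> edges G2 = {{u, v}}"
  shows "sidorenko \<lparr>verts = verts G1 \<union> verts G2, edges = edges G1 \<union> edges G2\<rparr>"
proof -
  have G: "finite_simple_graph G1" "finite_simple_graph G2" "bipartite G1" "bipartite G2"
    using assms by (auto simp: sidorenko_def)
  have "{u, v} \<in> edges G1 \<inter> edges G2"
    by (simp add: E)
  hence e: "{u, v} \<in> edges G1" "{u, v} \<in> edges G2"
    by simp_all
  have "u \<noteq> v"
    using G(1) e(1) by (force simp: finite_simple_graph_def doubleton_eq_iff)
  have "finite_simple_graph \<lparr>verts = verts G1 \<union> verts G2, edges = edges G1 \<union> edges G2\<rparr>"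
    unfolding finite_simple_graph_def
  proof (intro conjI ballI)
    show "finite (verts \<lparr>verts = verts G1 \<union> verts G2, edges = edges G1 \<union> edges G2\<rparr>)"
      using G(1,2) by (simp add: finite_simple_graph_def)
    fix e assume "e \<in> edges \<lparr>verts = verts G1 \<union> verts G2, edges = edges G1 \<union> edges G2\<rparr>"
    hence "e \<in> edges G1 \<or> e \<in> edges G2" by simp
    hence "\<exists>x\<in>verts G1 \<union> verts G2. \<exists>y\<in>verts G1 \<union> verts G2. x \<noteq> y \<and> e = {x, y}"
      using G(1,2) unfolding finite_simple_graph_def by (meson UnI1 UnI2)
    thus "\<exists>x\<in>verts \<lparr>verts = verts G1 \<union> verts G2, edges = edges G1 \<union> edges G2\<rparr>.
        \<exists>y\<in>verts \<lparr>verts = verts G1 \<union> verts G2, edges = edges G1 \<union> edges G2\<rparr>. x \<noteq> y \<and> e = {x, y}"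
      by simp
  qed
  thus ?thesis
    using hom_density_union_edge[OF assms(1,2) \<open>u \<noteq> v\<close> V E] bipartite_union_edge[OF G(3,4) V e]
    by (simp add: sidorenko_def)
qed

theorem theorem2:
  fixes H1 :: "'a graph" and H2 :: "'b graph"
    and e1 :: "'a set" and e2 :: "'b set"
    and u1 v1 :: 'a and u2 v2 :: 'b
  assumes "sidorenko H1" and "sidorenko H2"
    and "e1 \<in> edges H1" and "e2 \<in> edges H2"
    and "e1 = {u1, v1}" and "e2 = {u2, v2}"
  shows "sidorenko (glue_edges H1 u1 v1 H2 u2 v2)"
proof -
  \<comment> \<open>The gluing map restricted to \<open>H2\<close>. It is injective, so gluing
    amounts to relabelling \<open>H2\<close> by \<open>f\<close> and forming the ordinary union with
    the copy of \<open>H1\<close>.\<close>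
  define f :: "'b \<Rightarrow> 'a + 'b" where "f = id(Inr u2 := Inl u1, Inr v2 := Inl v1) \<circ> Inr"
  have H: "finite_simple_graph H1" "finite_simple_graph H2"
    using assms by (auto simp: sidorenko_def)
  have uv1: "u1 \<in> verts H1" "v1 \<in> verts H1" "u1 \<noteq> v1"
    using H(1) assms(3,5) by (force simp: finite_simple_graph_def doubleton_eq_iff)+
  have uv2: "u2 \<in> verts H2" "v2 \<in> verts H2" "u2 \<noteq> v2"
    using H(2) assms(4,6) by (force simp: finite_simple_graph_def doubleton_eq_iff)+
  have f: "f u2 = Inl u1" "f v2 = Inl v1" "\<And>w. w \<noteq> u2 \<Longrightarrow> w \<noteq> v2 \<Longrightarrow> f w = Inr w"
    using uv2 by (simp_all add: f_def)
  have inj: "inj f"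
    using uv1(3) by (auto simp: inj_def f_def split: if_splits)
  let ?G1 = "map_graph Inl H1 :: ('a + 'b) graph" and ?G2 = "map_graph f H2"
  have V: "verts ?G1 \<inter> verts ?G2 = {Inl u1, Inl v1}"
  proof (intro equalityI subsetI)
    fix w assume "w \<in> verts ?G1 \<inter> verts ?G2"
    then obtain x y where "w = Inl x" "w = f y"
      unfolding map_graph_def graph.simps by blast
    thus "w \<in> {Inl u1, Inl v1}"
      using f by (cases "y = u2 \<or> y = v2") auto
  next
    fix w assume "w \<in> {Inl u1, Inl v1 :: 'a + 'b}"
    moreover have "Inl u1 \<in> f ` verts H2" "Inl v1 \<in> f ` verts H2"
      using uv2 f by force+
    ultimately show "w \<in> verts ?G1 \<inter> verts ?G2"
      using uv1 by (auto simp: map_graph_def)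
  qed
  have E: "edges ?G1 \<inter> edges ?G2 = {{Inl u1, Inl v1}}"
  proof (intro equalityI subsetI)
    fix e assume "e \<in> edges ?G1 \<inter> edges ?G2"
    then obtain d e' where "e = Inl ` d" and "e' \<in> edges H2" "e = f ` e'"
      unfolding map_graph_def graph.simps by blast
    hence e': "e' \<in> edges H2" "e = f ` e'" "e \<subseteq> range Inl"
      by auto
    then obtain x y where xy: "x \<noteq> y" "e' = {x, y}"
      using H(2) by (auto simp: finite_simple_graph_def)
    \<comment> \<open>\<open>f\<close> sends every vertex other than \<open>u2\<close> and
      \<open>v2\<close> to the \<open>Inr\<close> side, so an edge whose image lies in the copy of
      \<open>H1\<close> has both ends in this pair.\<close>
    have "x \<in> {u2, v2}" "y \<in> {u2, v2}"
      using e' xy f(3)[of x] f(3)[of y] by auto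
    hence "e' = {u2, v2}"
      using xy by auto
    thus "e \<in> {{Inl u1, Inl v1}}"
      using e' f by simp
  next
    fix e assume "e \<in> {{Inl u1, Inl v1 :: 'a + 'b}}"
    hence "e = Inl ` e1" "e = f ` e2"
      using assms(5,6) f by simp_all
    thus "e \<in> edges ?G1 \<inter> edges ?G2"
      unfolding map_graph_def graph.simps using assms(3,4) by blast
  qed
  have "glue_edges H1 u1 v1 H2 u2 v2 =
      \<lparr>verts = verts ?G1 \<union> verts ?G2, edges = edges ?G1 \<union> edges ?G2\<rparr>"
  proof -
    define q :: "'a + 'b \<Rightarrow> 'a + 'b" where "q = id(Inr u2 := Inl u1, Inr v2 := Inl v1)"
    have "q (Inl x) = Inl x" "q (Inr y) = f y" for x y
      by (simp_all add: q_def f_def)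
    thus ?thesis
      unfolding glue_edges_def q_def[symmetric]
      by (simp add: map_graph_def disjoint_union_def Plus_def image_Un image_image)
  qed
  moreover have "sidorenko ?G1"
    by (rule sidorenko_map_graph[OF assms(1)]) simp
  moreover have "sidorenko ?G2"
    by (rule sidorenko_map_graph[OF assms(2)]) (rule inj_on_subset[OF inj], simp)
  ultimately show ?thesis
    using sidorenko_union_edge[OF _ _ V E] by simp
qed

end
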